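(* (1) There is a finite undirected graph that is $\mathbb{Z}_2^2$-connected but not $\mathbb{Z}_4$-connected. (2) There is a finite undirected graph that is $\mathbb{Z}_4$-connected but not $\mathbb{Z}_2^2$-connected.
   Context: Here $\mathbb{Z}_4$ is the cyclic group of order 4 and $\mathbb{Z}_2^2=\mathbb{Z}_2\times\mathbb{Z}_2$. Let $\Gamma$ be an abelian group, written additively. A $\Gamma$-flow in a digraph $G=(V,E)$ is a map $\varphi\colon E\to\Gamma$ such that for every vertex $v\in V$, $\sum_{e \text{ ends at } v}\varphi(e)=\sum_{e\text{ starts at }v}\varphi(e)$. A digraph $G=(V,E)$ is $\Gamma$-connected if for every mapping $h\colon E\to\Gamma$ there is a $\Gamma$-flow $\varphi$ on $G$ with $\varphi(e)\neq h(e)$ for every edge $e\in E$. This property does not change when the orientation of an edge is reversed; an undirected graph is called $\Gamma$-connected if some (equivalently, every) orientation of it is $\Gamma$-connected. *)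

theory Defs
  imports "Graph_Theory.Digraph" "HOL-Library.Numeral_Type" "HOL-Library.Product_Plus"
begin

definition is_flow :: "('v, 'e) pre_digraph \<Rightarrow> ('e \<Rightarrow> 'g::ab_group_add) \<Rightarrow> bool" where
  "is_flow D \<phi> \<longleftrightarrow> (\<forall>v\<in>verts D. (\<Sum>e\<in>in_arcs D v. \<phi> e) = (\<Sum>e\<in>out_arcs D v. \<phi> e))"

text \<open>The group is passed as a type, since it does not occur in the graph. The cyclic group of order
  4 is the type \<^typ>\<open>4\<close> of integers modulo 4, and its non-cyclic counterpart is \<^typ>\<open>2 \<times> 2\<close>
  with componentwise addition.\<close>

definition digraph_group_connected ::
  "'g::ab_group_add itself \<Rightarrow> ('v, 'e) pre_digraph \<Rightarrow> bool" where
  "digraph_group_connected T D \<longleftrightarrow>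
     (\<forall>h :: 'e \<Rightarrow> 'g. \<exists>\<phi> :: 'e \<Rightarrow> 'g. is_flow D \<phi> \<and> (\<forall>e\<in>arcs D. \<phi> e \<noteq> h e))"

definition finite_simple_graph :: "'v set \<Rightarrow> 'v set set \<Rightarrow> bool" where
  "finite_simple_graph V E \<longleftrightarrow> finite V \<and> (\<forall>e\<in>E. e \<subseteq> V \<and> card e = 2)"

text \<open>The arcs of an orientation are the undirected edges themselves; only the order of their two
  end vertices is chosen.\<close>

definition is_orientation :: "'v set \<Rightarrow> 'v set set \<Rightarrow> ('v, 'v set) pre_digraph \<Rightarrow> bool" where
  "is_orientation V E D \<longleftrightarrow>
     verts D = V \<and> arcs D = E \<and> (\<forall>e\<in>E. {tail D e, head D e} = e)"

definition graph_group_connected ::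
  "'g::ab_group_add itself \<Rightarrow> 'v set \<Rightarrow> 'v set set \<Rightarrow> bool" where
  "graph_group_connected T V E \<longleftrightarrow>
     (\<exists>D. is_orientation V E D \<and> digraph_group_connected T D)"

text \<open>The choice of the orientation is immaterial: reversing an arc amounts to negating the values
  of flows and of forbidden values on it.\<close>

lemma digraph_group_connected_reorient:
  fixes T :: "'g::ab_group_add itself"
  assumes fin: "finite_simple_graph V E"
    and D: "is_orientation V E D" and D': "is_orientation V E D'"
    and conn: "digraph_group_connected T D"
  shows "digraph_group_connected T D'"
  unfolding digraph_group_connected_def
proof
  fix h :: "'a set \<Rightarrow> 'g"
  define s :: "('a set \<Rightarrow> 'g) \<Rightarrow> 'a set \<Rightarrow> 'g"
    where "s f e = (if tail D' e = tail D e then f e else - f e)" for f e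
  obtain \<phi> where \<phi>: "is_flow D \<phi>" "\<forall>e\<in>arcs D. \<phi> e \<noteq> s h e"
    using conn unfolding digraph_group_connected_def by blast
  have E: "arcs D = E" "arcs D' = E" "verts D = V" "verts D' = V"
    using D D' by (auto simp: is_orientation_def)
  have "E \<subseteq> Pow V" "finite V"
    using fin by (auto simp: finite_simple_graph_def)
  then have finE: "finite E"
    using finite_subset by blast
  have net: "(\<Sum>e\<in>in_arcs H v. f e) = (\<Sum>e\<in>out_arcs H v. f e) \<longleftrightarrow>
      (\<Sum>e\<in>E. (if head H e = v then f e else 0) - (if tail H e = v then f e else 0)) = 0"
    if "arcs H = E" for H :: "('a, 'a set) pre_digraph" and f :: "'a set \<Rightarrow> 'g" and v
    using that finE by (simp add: in_arcs_def out_arcs_def sum_subtractf sum.inter_filter)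
  have "(if head D' e = v then s \<phi> e else 0) - (if tail D' e = v then s \<phi> e else 0) =
      (if head D e = v then \<phi> e else 0) - (if tail D e = v then \<phi> e else 0)"
    if e: "e \<in> E" for e v
  proof -
    have "{tail D e, head D e} = {tail D' e, head D' e}"
      using D D' e by (simp add: is_orientation_def)
    then have "tail D' e = tail D e \<and> head D' e = head D e \<or>
        tail D' e = head D e \<and> head D' e = tail D e"
      by (auto simp: doubleton_eq_iff)
    moreover have "tail D e \<noteq> head D e"
    proof
      assume "tail D e = head D e"
      moreover have "{tail D e, head D e} = e" "card e = 2"
        using D fin e by (simp_all add: is_orientation_def finite_simple_graph_def)
      ultimately have "card {head D e} = 2"
        by simp
      then show False
        by simp
    qed
    ultimately show ?thesis
      unfolding s_def by (elim disjE conjE) simp_all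
  qed
  then have "is_flow D' (s \<phi>)"
    using \<phi>(1) by (simp add: is_flow_def net E)
  moreover have "\<forall>e\<in>arcs D'. s \<phi> e \<noteq> h e"
  proof
    fix e assume "e \<in> arcs D'"
    then have "\<phi> e \<noteq> s h e"
      using \<phi>(2) E by simp
    then show "s \<phi> e \<noteq> h e"
      unfolding s_def by (metis minus_minus)
  qed
  ultimately show "\<exists>\<phi>. is_flow D' \<phi> \<and> (\<forall>e\<in>arcs D'. \<phi> e \<noteq> h e)"
    by blast
qed

end

theory Submission
  imports Defs
begin

text \<open>Shifting a flow by the forbidden values shows that a graph is group connected iff every
  boundary that sums to zero is the boundary of a nowhere-zero function on the edges. For a
  given boundary this is decided by a sweep that maintains the set of excess vectors, on the vertices
  touched but not yet finished, that nowhere-zero functions on the edges seen so far can produce: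
  an edge adds all nonzero multiples of a difference of unit vectors, and finishing a vertex
  intersects with a hyperplane. To treat all boundaries at once, every hyperplane is taken. Whether all
  completions succeed is monotone in the set and invariant under translations and
  automorphisms of the group, and up to these only a few dozen minimal sets
  occur at each stage.\<close>

subsection \<open>Sweeping over a graph\<close>

text \<open>A vertex of degree two forces one flow value, up to sign, through both its edges, so a
  subdivided edge acts as one edge with up to two forbidden values. Such pairs tell the groups
  apart: all pairs in Z_2^2 are equivalent under translations and automorphisms, while those in Z_4
  differ by an element of order two or of order four; and Z_2^2 has three subgroups of order two,
  Z_4 only one.

  The two halves differ in cost. Non-connectedness takes one boundary and one exact sweep,
  \<open>run\<close>. Connectedness concerns 4^14 and 4^10 boundaries, evaluated by the simplifier,
  so the search for symmetries stays outside: a witness names the symmetry, and \<open>check\<close>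
  tests one inclusion. A symmetry also changes the boundary still to be met; hence a set may only be
  replaced by one that succeeds for every boundary.

  The computation never mentions the groups: elements are digits and a subtraction table is a
  parameter, so one correctness proof serves both.\<close>

datatype digit = D0 | D1 | D2 | D3

lemma UNIV_digit: "UNIV = {D0, D1, D2, D3}"
  using digit.exhaust by auto

instance digit :: finite
  by standard (simp add: UNIV_digit)

lemma bij_digitI:
  fixes f :: "digit \<Rightarrow> 'a::finite"
  assumes "CARD('a) = 4" "distinct [f D0, f D1, f D2, f D3]"
  shows "bij f"
proof -
  have "inj f"
  proof (rule injI)
    fix p q assume "f p = f q"
    then show "p = q"
      using assms(2) by (cases p; cases q) auto
  qed
  moreover from this have "card (range f) = 4"
    by (simp add: card_image UNIV_digit)
  then have "range f = UNIV"
    using assms(1) by (intro card_subset_eq) auto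
  ultimately show ?thesis
    by (simp add: bij_def)
qed

text \<open>Sets of vectors over the group are stored as tries, branching on one coordinate per level;
  \<^term>\<open>Full\<close> stands for everything below it, at whatever depth it occurs.\<close>

datatype trie = Empty | Full | Node trie trie trie trie

fun child :: "trie \<Rightarrow> digit \<Rightarrow> trie" where
  "child (Node a b c d) q = (case q of D0 \<Rightarrow> a | D1 \<Rightarrow> b | D2 \<Rightarrow> c | D3 \<Rightarrow> d)"
| "child Empty q = Empty"
| "child Full q = Full"

fun has :: "trie \<Rightarrow> digit list \<Rightarrow> bool" where
  "has Empty qs \<longleftrightarrow> False"
| "has Full qs \<longleftrightarrow> True"
| "has (Node a b c d) [] \<longleftrightarrow> False"
| "has (Node a b c d) (q # qs) \<longleftrightarrow> has (child (Node a b c d) q) qs"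

fun join :: "trie \<Rightarrow> trie \<Rightarrow> trie" where
  "join Empty t = t"
| "join Full t = Full"
| "join (Node a b c d) Empty = Node a b c d"
| "join (Node a b c d) Full = Full"
| "join (Node a b c d) (Node a' b' c' d') = Node (join a a') (join b b') (join c c') (join d d')"

text \<open>This is the preimage under \<pi> in coordinate \<open>i\<close>, so adding k to that
  coordinate of every vector is relabelling by q - k.\<close>

fun relabel :: "nat \<Rightarrow> (digit \<Rightarrow> digit) \<Rightarrow> trie \<Rightarrow> trie" where
  "relabel i \<pi> Empty = Empty"
| "relabel i \<pi> Full = Full"
| "relabel 0 \<pi> (Node a b c d) = (let f = (\<lambda>q. child (Node a b c d) (\<pi> q)) in Node (f D0) (f D1) (f D2) (f D3))"
| "relabel (Suc i) \<pi> (Node a b c d) =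
     Node (relabel i \<pi> a) (relabel i \<pi> b) (relabel i \<pi> c) (relabel i \<pi> d)"

fun slice :: "nat \<Rightarrow> digit \<Rightarrow> trie \<Rightarrow> trie" where
  "slice i q Empty = Empty"
| "slice i q Full = Full"
| "slice 0 q (Node a b c d) = child (Node a b c d) q"
| "slice (Suc i) q (Node a b c d) = Node (slice i q a) (slice i q b) (slice i q c) (slice i q d)"

text \<open>Value \<open>k\<close> on an edge raises the excess at its head (level \<open>j\<close>)
  and lowers it at its tail (level \<open>i\<close>). Only subtraction is tabulated, so
  \<open>sub D0 k\<close> serves as -k.\<close>

definition spread :: "(digit \<Rightarrow> digit \<Rightarrow> digit) \<Rightarrow> nat \<Rightarrow> nat \<Rightarrow> trie \<Rightarrow> trie" where
  "spread sub i j t =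
     (let s = (\<lambda>k. relabel i (\<lambda>q. sub q (sub D0 k)) (relabel j (\<lambda>q. sub q k) t))
      in join (s D1) (join (s D2) (s D3)))"

text \<open>Tests by one simultaneous descent whether the preimage of the first trie under the
  coordinatewise map from q to \<pi> (q - k) lies in the second. The test is sufficient only:
  \<open>Full\<close> is matched against a literal \<open>Full\<close>. A \<open>Node\<close> left
  over at the end of \<open>ks\<close> passes because it does not hold the empty vector.\<close>

fun covers :: "(digit \<Rightarrow> digit \<Rightarrow> digit) \<Rightarrow> (digit \<Rightarrow> digit) \<Rightarrow> digit list \<Rightarrow> trie \<Rightarrow> trie \<Rightarrow> bool" where
  "covers sub \<pi> ks Empty t \<longleftrightarrow> True"
| "covers sub \<pi> ks Full t \<longleftrightarrow> t = Full"
| "covers sub \<pi> [] (Node a b c d) t \<longleftrightarrow> True"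
| "covers sub \<pi> (k # ks) (Node a b c d) t \<longleftrightarrow>
     (let f = (\<lambda>q. covers sub \<pi> ks (child (Node a b c d) (\<pi> (sub q k))) (child t q))
      in f D0 \<and> f D1 \<and> f D2 \<and> f D3)"

text \<open>A sweep over a graph. A vertex is opened before, and closed after, all its edges. One vertex is never
  opened, because its balance follows from that of the others: \<open>pos\<close> places it behind the
  last coordinate, where \<open>relabel\<close> has no effect.\<close>

datatype step = Open nat | Edge nat nat | Close nat

fun opens :: "step list \<Rightarrow> nat list" where
  "opens [] = []"
| "opens (Open v # p) = v # opens p"
| "opens (Edge u w # p) = opens p"
| "opens (Close v # p) = opens p"

fun edges :: "step list \<Rightarrow> (nat \<times> nat) list" where
  "edges [] = []"
| "edges (Open v # p) = edges p"
| "edges (Edge u w # p) = (u, w) # edges p"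
| "edges (Close v # p) = edges p"

text \<open>The root needs no clause of its own: an edge may meet a vertex outside \<open>vs\<close>
  that is not opened later. As closed vertices get no further edges, such a vertex is never opened
  in a program started from \<open>[]\<close>.\<close>

fun valid :: "step list \<Rightarrow> nat list \<Rightarrow> bool" where
  "valid [] vs \<longleftrightarrow> vs = []"
| "valid (Open v # p) vs \<longleftrightarrow> v \<notin> set vs \<and> v \<notin> set (opens p) \<and> valid p (v # vs)"
| "valid (Edge u w # p) vs \<longleftrightarrow> u \<noteq> w \<and> u \<notin> set (opens p) \<and> w \<notin> set (opens p) \<and> valid p vs"
| "valid (Close v # p) vs \<longleftrightarrow> v \<in> set vs \<and> v \<notin> set (opens p) \<and>
     (\<forall>(u, w)\<in>set (edges p). u \<noteq> v \<and> w \<noteq> v) \<and> valid p (remove1 v vs)"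

fun pos :: "nat \<Rightarrow> nat list \<Rightarrow> nat" where
  "pos v [] = 0"
| "pos v (w # ws) = (if v = w then 0 else Suc (pos v ws))"

text \<open>A new coordinate goes on top and starts at \<open>D0\<close>, the zero of the group.
  With no coordinate left, a trie holds the empty vector iff it is \<open>Full\<close>.\<close>

fun run :: "(digit \<Rightarrow> digit \<Rightarrow> digit) \<Rightarrow> (nat \<Rightarrow> digit) \<Rightarrow> step list \<Rightarrow> nat list \<Rightarrow> trie \<Rightarrow> bool" where
  "run sub \<beta> [] vs t \<longleftrightarrow> t = Full"
| "run sub \<beta> (Open v # p) vs t \<longleftrightarrow> run sub \<beta> p (v # vs) (Node t Empty Empty Empty)"
| "run sub \<beta> (Edge u w # p) vs t \<longleftrightarrow> run sub \<beta> p vs (spread sub (pos u vs) (pos w vs) t)"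
| "run sub \<beta> (Close v # p) vs t \<longleftrightarrow> run sub \<beta> p (remove1 v vs) (slice (pos v vs) (\<beta> v) t)"

text \<open>A set of excess vectors that is obtained by closing a vertex is either kept, or it is
  dropped in favour of the \<open>j\<close>-th kept one in \<open>Cover j k ks\<close>: subtracting
  \<open>ks\<close> and then applying the \<open>k\<close>-th automorphism maps some subset of it
  onto that kept set.\<close>

datatype witness = Keep | Cover nat nat "digit list"

text \<open>The index \<open>j\<close> counts kept sets only, wherever they stand in the list. A
  covered set thus rests directly on a set that the sweep carries on, and no circular justification
  can arise.\<close>

fun check :: "(digit \<Rightarrow> digit \<Rightarrow> digit) \<Rightarrow> (digit \<Rightarrow> digit) list \<Rightarrow> step list \<Rightarrow> witness list list \<Rightarrow>
    nat list \<Rightarrow> trie list \<Rightarrow> bool" where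
  "check sub \<pi>s [] cs vs ts \<longleftrightarrow> list_all (\<lambda>t. t = Full) ts"
| "check sub \<pi>s (Open v # p) cs vs ts \<longleftrightarrow>
     check sub \<pi>s p cs (v # vs) (map (\<lambda>t. Node t Empty Empty Empty) ts)"
| "check sub \<pi>s (Edge u w # p) cs vs ts \<longleftrightarrow>
     (let i = pos u vs; j = pos w vs in check sub \<pi>s p cs vs (map (spread sub i j) ts))"
| "check sub \<pi>s (Close v # p) [] vs ts \<longleftrightarrow> False"
| "check sub \<pi>s (Close v # p) (c # cs) vs ts \<longleftrightarrow>
     (let i = pos v vs; vs' = remove1 v vs;
          rs = concat (map (\<lambda>t. [slice i D0 t, slice i D1 t, slice i D2 t, slice i D3 t]) ts);
          z = zip rs c;
          reps = map fst (filter (\<lambda>(r, e). e = Keep) z)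
      in length c = length rs \<and>
         list_all (\<lambda>(r, e). case e of Keep \<Rightarrow> True
           | Cover j k ks \<Rightarrow> j < length reps \<and> k < length \<pi>s \<and> length ks = length vs' \<and>
               covers sub (\<pi>s ! k) ks (reps ! j) r) z \<and>
         check sub \<pi>s p cs vs' reps)"

subsection \<open>Correctness of the sweep\<close>

lemma has_Cons: "has t (q # qs) \<longleftrightarrow> has (child t q) qs"
  by (cases t) auto

lemma has_join: "has (join s t) qs \<longleftrightarrow> has s qs \<or> has t qs"
proof (induction s t arbitrary: qs rule: join.induct)
  case (5 a b c d a' b' c' d')
  then show ?case
    by (cases qs) (auto split: digit.splits)
qed auto

lemma has_relabel:
  "has (relabel i \<pi> t) qs \<longleftrightarrow> has t (if i < length qs then qs[i := \<pi> (qs ! i)] else qs)"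
proof (induction i \<pi> t arbitrary: qs rule: relabel.induct)
  case (3 \<pi> a b c d)
  then show ?case
    by (cases qs) (auto simp: Let_def split: digit.splits)
next
  case (4 i \<pi> a b c d)
  then show ?case
    by (cases qs) (auto split: digit.splits)
qed auto

lemma has_slice:
  "i \<le> length qs \<Longrightarrow> has (slice i q t) qs \<longleftrightarrow> has t (take i qs @ q # drop i qs)"
proof (induction i q t arbitrary: qs rule: slice.induct)
  case (4 i q a b c d)
  then show ?case
    by (cases qs) (auto split: digit.splits)
qed auto

lemma covers_has:
  assumes "covers sub \<pi> ks s t" "length qs = length ks"
    "has s (map2 (\<lambda>q k. \<pi> (sub q k)) qs ks)"
  shows "has t qs"
  using assms
proof (induction sub \<pi> ks s t arbitrary: qs rule: covers.induct)
  case (4 sub \<pi> k ks a b c d t)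
  then obtain q qs' where qs: "qs = q # qs'" "length qs' = length ks"
    by (cases qs) auto
  show ?case
    using 4 qs by (cases q) (auto simp: has_Cons Let_def)
qed auto

lemma pos_split:
  assumes "v \<in> set vs" "distinct vs"
  shows "vs = take (pos v vs) vs @ v # drop (Suc (pos v vs)) vs"
    "remove1 v vs = take (pos v vs) vs @ drop (Suc (pos v vs)) vs"
    "pos v vs < length vs" "vs ! pos v vs = v"
  using assms by (induction vs) auto

lemma pos_notin: "v \<notin> set vs \<Longrightarrow> pos v vs = length vs"
  by (induction vs) auto

text \<open>Here \<open>b\<close> is the excess so far and \<open>es\<close> lists the edges still
  to come. Choosing values edge by edge, not as one function, lets the induction over a program peel
  off a single edge. Nothing is demanded outside \<open>W\<close>, which will leave out the root and
  the closed vertices.\<close>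

fun solvable :: "nat set \<Rightarrow> (nat \<times> nat) list \<Rightarrow> (nat \<Rightarrow> 'g::ab_group_add) \<Rightarrow> (nat \<Rightarrow> 'g) \<Rightarrow> bool" where
  "solvable W [] b \<beta> \<longleftrightarrow> (\<forall>v\<in>W. b v = \<beta> v)"
| "solvable W ((u, w) # es) b \<beta> \<longleftrightarrow> (\<exists>x. x \<noteq> 0 \<and>
     solvable W es (\<lambda>v. b v + ((if w = v then x else 0) - (if u = v then x else 0))) \<beta>)"

text \<open>No remaining edge meets \<open>v\<close>, so its excess is already final.\<close>

lemma solvable_remove:
  assumes "v \<in> W" "\<forall>(u, w)\<in>set es. u \<noteq> v \<and> w \<noteq> v"
  shows "solvable W es b \<beta> \<longleftrightarrow> b v = \<beta> v \<and> solvable (W - {v}) es b \<beta>"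
  using assms(2)
proof (induction es arbitrary: b)
  case Nil
  then show ?case
    using assms(1) by auto
next
  case (Cons e es)
  then show ?case
    by (cases e) auto
qed

lemma solvable_update:
  assumes "v \<notin> W" "\<forall>(u, w)\<in>set es. u \<noteq> v \<and> w \<noteq> v"
  shows "solvable W es (b(v := c)) \<beta> \<longleftrightarrow> solvable W es b \<beta>"
  using assms(2)
proof (induction es arbitrary: b)
  case Nil
  then show ?case
    using assms(1) by auto
next
  case (Cons e es)
  obtain u w where e: "e = (u, w)"
    by fastforce
  have *: "(\<lambda>v'. (b(v := c)) v' + ((if w = v' then x else 0) - (if u = v' then x else 0))) =
      (\<lambda>v'. b v' + ((if w = v' then x else 0) - (if u = v' then x else 0)))(v := c)" for x
    using Cons.prems e by auto
  have "\<forall>(u, w)\<in>set es. u \<noteq> v \<and> w \<noteq> v"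
    using Cons.prems by simp
  note IH = Cons.IH[OF this]
  show ?case
    unfolding e solvable.simps * IH ..
qed

text \<open>Each edge value x becomes f x, which is nonzero because \<open>f\<close> has trivial
  kernel. The shift \<tau> changes the present excess and the goal alike.\<close>

lemma solvable_affine:
  assumes f: "\<And>x y. f (x + y) = f x + f y" "\<And>x. f x = 0 \<Longrightarrow> x = 0"
    and "solvable W es b \<beta>"
  shows "solvable W es (\<lambda>v. f (b v) + \<tau> v) (\<lambda>v. f (\<beta> v) + \<tau> v)"
  using assms(3)
proof (induction es arbitrary: b)
  case (Cons e es)
  obtain u w where e: "e = (u, w)"
    by fastforce
  have f0: "f 0 = 0"
    using f(1)[of 0 0] by simp
  have fd: "f (x - y) = f x - f y" for x y
    using f(1)[of "x - y" y] by simp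
  obtain x where x: "x \<noteq> 0"
    "solvable W es (\<lambda>v. b v + ((if w = v then x else 0) - (if u = v then x else 0))) \<beta>"
    using Cons.prems e by auto
  have *: "(\<lambda>v. f (b v + ((if w = v then x else 0) - (if u = v then x else 0))) + \<tau> v) =
      (\<lambda>v. f (b v) + \<tau> v + ((if w = v then f x else 0) - (if u = v then f x else 0)))"
    by (auto simp: f(1) fd f0)
  show ?case
    unfolding e solvable.simps using x(1) f(2) Cons.IH[OF x(2)] unfolding * by blast
qed auto

section \<open>Sweeps over a group with numbered elements\<close>

locale numbering =
  fixes val :: "digit \<Rightarrow> 'g::ab_group_add" and sub :: "digit \<Rightarrow> digit \<Rightarrow> digit"
  assumes bij: "bij val"
    and val_0: "val D0 = 0"
    and val_sub: "val (sub p q) = val p - val q"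
begin

definition vec :: "nat list \<Rightarrow> (nat \<Rightarrow> 'g) \<Rightarrow> digit list" where
  "vec vs b = map (\<lambda>v. inv val (b v)) vs"

lemma inv_val [simp]: "inv val (val q) = q" "val (inv val x) = x"
  using bij by (simp_all add: bij_is_inj bij_is_surj surj_f_inv_f)

lemma inv_val_eq: "inv val x = q \<longleftrightarrow> x = val q"
  by auto

lemma inv_val_diff: "inv val (x - val k) = sub (inv val x) k"
  by (simp add: inv_val_eq val_sub)

lemma inv_val_0: "inv val x = D0 \<longleftrightarrow> x = 0"
  by (simp add: inv_val_eq val_0)

lemma length_vec [simp]: "length (vec vs b) = length vs"
  by (simp add: vec_def)

text \<open>This also covers the root: \<open>pos\<close> is then \<open>length vs\<close>, where
  \<open>relabel\<close> changes no membership of vectors of that length, and \<open>vec\<close>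
  does not see the update.\<close>

lemma has_relabel_vec:
  assumes "distinct vs"
  shows "has (relabel (pos v vs) (\<lambda>q. sub q k) t) (vec vs b) \<longleftrightarrow> has t (vec vs (b(v := b v - val k)))"
proof (cases "v \<in> set vs")
  case True
  note p = pos_split(3,4)[OF True assms]
  have "(vec vs b)[pos v vs := sub (vec vs b ! pos v vs) k] = vec vs (b(v := b v - val k))"
  proof (rule nth_equalityI)
    fix i assume "i < length ((vec vs b)[pos v vs := sub (vec vs b ! pos v vs) k])"
    then have i: "i < length vs"
      by simp
    then have "vs ! i = v \<longleftrightarrow> i = pos v vs"
      using p assms by (metis nth_eq_iff_index_eq)
    then show "(vec vs b)[pos v vs := sub (vec vs b ! pos v vs) k] ! i = vec vs (b(v := b v - val k)) ! i"
      using i p by (auto simp: vec_def inv_val_diff)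
  qed simp
  then show ?thesis
    using p by (simp add: has_relabel)
next
  case False
  then have "vec vs (b(v := b v - val k)) = vec vs b"
    by (auto simp: vec_def)
  then show ?thesis
    using False by (simp add: has_relabel pos_notin)
qed

lemma ex_nonzero: "(\<exists>x. x \<noteq> 0 \<and> P x) \<longleftrightarrow> P (val D1) \<or> P (val D2) \<or> P (val D3)"
proof -
  have "(\<exists>x. x \<noteq> 0 \<and> P x) \<longleftrightarrow> (\<exists>k. k \<noteq> D0 \<and> P (val k))"
    by (metis inv_val val_0)
  also have "\<dots> \<longleftrightarrow> P (val D1) \<or> P (val D2) \<or> P (val D3)"
    by (metis digit.exhaust digit.distinct(1,3,5))
  finally show ?thesis .
qed

lemma has_spread:
  assumes "distinct vs" "u \<noteq> w"
  shows "has (spread sub (pos u vs) (pos w vs) t) (vec vs b) \<longleftrightarrow> (\<exists>x. x \<noteq> 0 \<and>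
    has t (vec vs (\<lambda>v. b v - ((if w = v then x else 0) - (if u = v then x else 0)))))"
proof -
  have "has (relabel (pos u vs) (\<lambda>q. sub q (sub D0 k)) (relabel (pos w vs) (\<lambda>q. sub q k) t)) (vec vs b) \<longleftrightarrow>
      has t (vec vs (\<lambda>v. b v - ((if w = v then val k else 0) - (if u = v then val k else 0))))" for k
  proof -
    have "(b(u := b u - val (sub D0 k)))(w := (b(u := b u - val (sub D0 k))) w - val k) =
        (\<lambda>v. b v - ((if w = v then val k else 0) - (if u = v then val k else 0)))"
      using assms(2) by (auto simp: val_sub val_0)
    then show ?thesis
      unfolding has_relabel_vec[OF assms(1)] by (rule arg_cong)
  qed
  then show ?thesis
    by (simp add: spread_def has_join Let_def ex_nonzero)
qed

text \<open>The trie knows only the coordinates in \<open>vs\<close>. A vertex still to be opened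
  has met no edge, so its excess is 0; at the root and at closed vertices \<open>b\<close> is
  free.\<close>

definition reaches :: "step list \<Rightarrow> nat list \<Rightarrow> trie \<Rightarrow> (nat \<Rightarrow> 'g) \<Rightarrow> bool" where
  "reaches p vs t b \<longleftrightarrow> has t (vec vs b) \<and> (\<forall>v\<in>set (opens p). b v = 0)"

definition completable :: "step list \<Rightarrow> nat list \<Rightarrow> trie \<Rightarrow> (nat \<Rightarrow> 'g) \<Rightarrow> bool" where
  "completable p vs t \<beta> \<longleftrightarrow>
     (\<exists>b. reaches p vs t b \<and> solvable (set vs \<union> set (opens p)) (edges p) b \<beta>)"

text \<open>Each step moves one condition into the trie: opening moves the zero excess of a new
  vertex, an edge moves the choice of its value out of \<open>solvable\<close>, and closing turns
  the demand at \<open>v\<close> into a slice.\<close>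

lemma run_iff_completable:
  assumes "valid p vs" "distinct vs"
  shows "run sub \<beta> p vs t \<longleftrightarrow> completable p vs t (\<lambda>v. val (\<beta> v))"
  using assms
proof (induction p arbitrary: vs t)
  case Nil
  then show ?case
    by (cases t) (auto simp: completable_def reaches_def vec_def)
next
  case (Cons s p)
  show ?case
  proof (cases s)
    case (Open v)
    have "reaches p (v # vs) (Node t Empty Empty Empty) b \<longleftrightarrow> reaches (Open v # p) vs t b" for b
    proof -
      have "has (Node t Empty Empty Empty) (q # qs) \<longleftrightarrow> q = D0 \<and> has t qs" for q qs
        by (cases q) auto
      then show ?thesis
        by (auto simp: reaches_def vec_def inv_val_0)
    qed
    then show ?thesis
      using Cons Open by (simp add: completable_def)
  next
    case (Edge u w)
    let ?W = "set vs \<union> set (opens p)" and ?\<beta> = "\<lambda>v. val (\<beta> v)"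
    define d where "d x v = (if w = v then x else 0) - (if u = v then x else 0)" for x :: 'g and v
    have dx: "(\<lambda>v. b v + d x v - d x v) = b" "(\<lambda>v. b v - d x v + d x v) = b" for b x
      by auto
    \<comment> \<open>\<open>valid\<close> forbids edges at vertices opened later, so these keep
      excess 0.\<close>
    have z: "d x v = 0" if "v \<in> set (opens p)" for v x
      using that Cons.prems Edge by (auto simp: d_def)
    have r: "reaches p vs (spread sub (pos u vs) (pos w vs) t) b \<longleftrightarrow>
        (\<exists>x. x \<noteq> 0 \<and> reaches (Edge u w # p) vs t (\<lambda>v. b v - d x v))" for b
      using Cons.prems Edge by (auto simp: reaches_def has_spread d_def[symmetric] z)
    have "completable p vs (spread sub (pos u vs) (pos w vs) t) ?\<beta> \<longleftrightarrow>
        (\<exists>b x. x \<noteq> 0 \<and> reaches (Edge u w # p) vs t (\<lambda>v. b v - d x v) \<and> solvable ?W (edges p) b ?\<beta>)"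
      unfolding completable_def r by blast
    \<comment> \<open>Pass from the excess after the edge to the excess before it.\<close>
    also have "\<dots> \<longleftrightarrow> (\<exists>b x. x \<noteq> 0 \<and> reaches (Edge u w # p) vs t b \<and>
        solvable ?W (edges p) (\<lambda>v. b v + d x v) ?\<beta>)"
    proof (intro iffI; elim exE conjE)
      fix b x assume *: "x \<noteq> 0" "reaches (Edge u w # p) vs t (\<lambda>v. b v - d x v)"
        "solvable ?W (edges p) b ?\<beta>"
      then show "\<exists>b x. x \<noteq> 0 \<and> reaches (Edge u w # p) vs t b \<and>
          solvable ?W (edges p) (\<lambda>v. b v + d x v) ?\<beta>"
        by (intro exI[of _ "\<lambda>v. b v - d x v"] exI[of _ x]) (simp add: dx)
    next
      fix b x assume *: "x \<noteq> 0" "reaches (Edge u w # p) vs t b"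
        "solvable ?W (edges p) (\<lambda>v. b v + d x v) ?\<beta>"
      then show "\<exists>b x. x \<noteq> 0 \<and> reaches (Edge u w # p) vs t (\<lambda>v. b v - d x v) \<and>
          solvable ?W (edges p) b ?\<beta>"
        by (intro exI[of _ "\<lambda>v. b v + d x v"] exI[of _ x]) (simp add: dx)
    qed
    also have "\<dots> \<longleftrightarrow> completable (Edge u w # p) vs t ?\<beta>"
      unfolding completable_def d_def by auto
    finally show ?thesis
      using Cons Edge by simp
  next
    case (Close v)
    let ?vs = "remove1 v vs" and ?i = "pos v vs" and ?\<beta> = "\<lambda>v. val (\<beta> v)"
    let ?W = "set vs \<union> set (opens p)"
    have v: "v \<in> set vs" "v \<notin> set (opens p)" "\<forall>(u, w)\<in>set (edges p). u \<noteq> v \<and> w \<noteq> v"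
      "valid p ?vs" "distinct ?vs"
      using Cons.prems Close by auto
    note split = pos_split[OF v(1) Cons.prems(2)]
    have W: "set ?vs \<union> set (opens p) = ?W - {v}"
      using v Cons.prems(2) by auto
    have h: "has (slice ?i q t) (vec ?vs b) \<longleftrightarrow> has t (vec vs (b(v := val q)))" for q b
    proof -
      have "vec vs (b(v := val q)) = map (\<lambda>y. inv val ((b(v := val q)) y)) (take ?i vs @ v # drop (Suc ?i) vs)"
        unfolding vec_def using split(1) by simp
      also have "\<dots> = take ?i (vec ?vs b) @ q # drop ?i (vec ?vs b)"
      proof -
        have "distinct (take ?i vs @ v # drop (Suc ?i) vs)"
          using split(1) Cons.prems(2) by simp
        then have "v \<notin> set (take ?i vs)" "v \<notin> set (drop (Suc ?i) vs)"
          by auto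
        then have "map (\<lambda>y. inv val ((b(v := val q)) y)) (take ?i vs) = map (\<lambda>y. inv val (b y)) (take ?i vs)"
          "map (\<lambda>y. inv val ((b(v := val q)) y)) (drop (Suc ?i) vs) = map (\<lambda>y. inv val (b y)) (drop (Suc ?i) vs)"
          by auto
        then show ?thesis
          using split(3) by (simp add: vec_def split(2))
      qed
      finally show ?thesis
        using split(3) v(1) by (simp add: has_slice length_remove1)
    qed
    have "completable p ?vs (slice ?i (\<beta> v) t) ?\<beta> \<longleftrightarrow> (\<exists>b. has t (vec vs (b(v := ?\<beta> v))) \<and>
        (\<forall>y\<in>set (opens p). b y = 0) \<and> solvable (?W - {v}) (edges p) b ?\<beta>)"
      by (simp add: completable_def reaches_def h W)
    \<comment> \<open>After the slice the value of \<open>b\<close> at \<open>v\<close> is free, as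
      no remaining edge meets \<open>v\<close>; it can be set to the demanded one.\<close>
    also have "\<dots> \<longleftrightarrow> (\<exists>b. has t (vec vs b) \<and> (\<forall>y\<in>set (opens p). b y = 0) \<and>
        b v = ?\<beta> v \<and> solvable (?W - {v}) (edges p) b ?\<beta>)" (is "?L \<longleftrightarrow> ?R")
    proof
      assume ?L
      then obtain b where b: "has t (vec vs (b(v := ?\<beta> v)))" "\<forall>y\<in>set (opens p). b y = 0"
        "solvable (?W - {v}) (edges p) b ?\<beta>"
        by blast
      show ?R
        using b v(2,3) by (intro exI[of _ "b(v := ?\<beta> v)"]) (auto simp: solvable_update)
    next
      assume ?R
      then show ?L
        by (metis fun_upd_triv)
    qed
    also have "\<dots> \<longleftrightarrow> completable (Close v # p) vs t ?\<beta>"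
      using v(1,3) by (auto simp: completable_def reaches_def solvable_remove[of v ?W])
    finally show ?thesis
      using Cons.IH[OF v(4,5)] Close by simp
  qed
qed

text \<open>To meet \<beta> from \<open>t\<close>, meet the transformed boundary g (\<beta> -
  \<tau>) from \<open>s\<close> and carry the solution back by f and the shift \<tau>. This is why
  \<open>s\<close> is assumed to succeed for all boundaries.\<close>

lemma completable_covers:
  assumes cov: "covers sub \<pi> ks s t" "length ks = length vs" and dist: "distinct vs"
    and new: "set vs \<inter> set (opens p) = {}"
    and \<pi>: "\<And>p q. \<pi> (sub p q) = sub (\<pi> p) (\<pi> q)" "bij \<pi>"
    and s: "\<And>\<beta>. completable p vs s \<beta>"
  shows "completable p vs t \<beta>"
proof -
  define g where "g x = val (\<pi> (inv val x))" for x
  define f where "f x = val (inv \<pi> (inv val x))" for x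
  have fg: "f (g x) = x" "g (f x) = x" for x
    using \<pi>(2) by (simp_all add: f_def g_def bij_is_inj bij_is_surj surj_f_inv_f)
  have g_diff: "g (x - y) = g x - g y" for x y
  proof -
    have "inv val (x - y) = sub (inv val x) (inv val y)"
      by (simp add: inv_val_eq val_sub)
    then show ?thesis
      by (simp add: g_def \<pi>(1) val_sub)
  qed
  have f_diff: "f (x - y) = f x - f y" for x y
    by (metis fg g_diff)
  have f0: "f 0 = 0"
    using f_diff[of 0 0] by simp
  have f_add: "f (x + y) = f x + f y" for x y
    using f_diff[of "x + y" y] by simp
  have f_eq0: "x = 0" if "f x = 0" for x
    using that f0 fg by metis
  \<comment> \<open>The value 0 off \<open>vs\<close> matters: vertices still to be opened must keep
    excess 0 after the shift.\<close>
  define \<tau> where "\<tau> v = (if v \<in> set vs then val (ks ! pos v vs) else 0)" for v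
  obtain b where b: "reaches p vs s b"
    "solvable (set vs \<union> set (opens p)) (edges p) b (\<lambda>v. g (\<beta> v - \<tau> v))"
    using s[of "\<lambda>v. g (\<beta> v - \<tau> v)"] unfolding completable_def by blast
  let ?b = "\<lambda>v. f (b v) + \<tau> v"
  have "solvable (set vs \<union> set (opens p)) (edges p) ?b \<beta>"
    using solvable_affine[OF f_add f_eq0 b(2), of \<tau>] by (simp add: fg)
  moreover have "has t (vec vs ?b)"
  proof (rule covers_has[OF cov(1)])
    have "map2 (\<lambda>q k. \<pi> (sub q k)) (vec vs ?b) ks = vec vs b"
    proof (rule nth_equalityI)
      fix i assume "i < length (map2 (\<lambda>q k. \<pi> (sub q k)) (vec vs ?b) ks)"
      then have i: "i < length vs"
        by simp
      have "pos (vs ! i) vs = i"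
        using pos_split(3,4)[of "vs ! i" vs] i dist by (metis nth_eq_iff_index_eq nth_mem)
      then have "\<tau> (vs ! i) = val (ks ! i)"
        using i by (simp add: \<tau>_def)
      moreover have "\<pi> (inv val (f x)) = inv val x" for x
        using fg(2)[of x] by (metis g_def inv_val(1))
      ultimately show "map2 (\<lambda>q k. \<pi> (sub q k)) (vec vs ?b) ks ! i = vec vs b ! i"
        using i cov(2) by (simp add: vec_def flip: inv_val_diff)
    qed (simp add: cov(2))
    then show "has s (map2 (\<lambda>q k. \<pi> (sub q k)) (vec vs ?b) ks)"
      using b(1) by (simp add: reaches_def)
  qed (simp add: cov(2))
  moreover have "\<forall>v\<in>set (opens p). ?b v = 0"
    using b(1) new by (auto simp: reaches_def \<tau>_def f0)
  ultimately show ?thesis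
    unfolding completable_def reaches_def by blast
qed

text \<open>\<beta> varies in the induction because a \<open>Cover\<close> step appeals to its kept
  set with a different boundary. The detour through \<open>completable\<close> is what makes
  symmetries applicable.\<close>

lemma check_run:
  assumes "valid p vs" "distinct vs" "set vs \<inter> set (opens p) = {}"
    and \<pi>s: "\<And>\<pi>. \<pi> \<in> set \<pi>s \<Longrightarrow> bij \<pi> \<and> (\<forall>p q. \<pi> (sub p q) = sub (\<pi> p) (\<pi> q))"
    and "check sub \<pi>s p cs vs ts" "t \<in> set ts"
  shows "run sub \<beta> p vs t"
  using assms(1-3,5,6)
proof (induction p arbitrary: cs vs ts t \<beta>)
  case Nil
  then show ?case
    by (auto simp: list_all_iff)
next
  case (Cons s p)
  show ?case
  proof (cases s)
    case (Open v)
    show ?thesis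
      using Cons.prems Cons.IH[of "v # vs" cs "map (\<lambda>t. Node t Empty Empty Empty) ts"] Open by auto
  next
    case (Edge u w)
    show ?thesis
      using Cons.prems Cons.IH[of vs cs "map (spread sub (pos u vs) (pos w vs)) ts"] Edge
      by (auto simp: Let_def)
  next
    case (Close v)
    then obtain c cs' where cs: "cs = c # cs'"
      using Cons.prems(4) by (cases cs) auto
    define vs' where "vs' = remove1 v vs"
    define rs where "rs = concat (map (\<lambda>t. [slice (pos v vs) D0 t, slice (pos v vs) D1 t,
      slice (pos v vs) D2 t, slice (pos v vs) D3 t]) ts)"
    define reps where "reps = map fst (filter (\<lambda>(r, e). e = Keep) (zip rs c))"
    have chk: "length c = length rs" "check sub \<pi>s p cs' vs' reps"
      "\<And>r e. (r, e) \<in> set (zip rs c) \<Longrightarrow> case e of Keep \<Rightarrow> True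
         | Cover j k ks \<Rightarrow> j < length reps \<and> k < length \<pi>s \<and> length ks = length vs' \<and>
             covers sub (\<pi>s ! k) ks (reps ! j) r"
      using Cons.prems(4) unfolding Close cs check.simps Let_def
        rs_def[symmetric] reps_def[symmetric] vs'_def[symmetric]
      by (auto simp: list_all_iff)
    have vs': "valid p vs'" "distinct vs'" "set vs' \<inter> set (opens p) = {}"
      using Cons.prems(1-3) Close by (auto simp: vs'_def)
    note IH = Cons.IH[OF vs' chk(2)]
    have run: "run sub \<beta> p vs' r" if r: "r \<in> set rs" for r \<beta>
    proof -
      obtain e where e: "(r, e) \<in> set (zip rs c)"
        using r chk(1) by (metis in_set_impl_in_set_zip1)
      show ?thesis
      proof (cases e)
        case Keep
        then have "r \<in> set reps"
          using e by (force simp: reps_def)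
        then show ?thesis
          by (rule IH)
      next
        case (Cover j k ks)
        then have *: "j < length reps" "k < length \<pi>s" "length ks = length vs'"
          "covers sub (\<pi>s ! k) ks (reps ! j) r"
          using chk(3)[OF e] by auto
        \<comment> \<open>Digit-valued boundaries reach all group-valued ones, as \<open>val\<close>
          is onto.\<close>
        have "completable p vs' (reps ! j) \<beta>" for \<beta>
        proof -
          have "run sub (\<lambda>v. inv val (\<beta> v)) p vs' (reps ! j)"
            using * by (intro IH) simp
          then show ?thesis
            by (simp add: run_iff_completable[OF vs'(1,2)])
        qed
        moreover have "bij (\<pi>s ! k)" "\<And>p q. (\<pi>s ! k) (sub p q) = sub ((\<pi>s ! k) p) ((\<pi>s ! k) q)"
          using \<pi>s *(2) nth_mem by blast+
        ultimately show ?thesis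
          unfolding run_iff_completable[OF vs'(1,2)]
          using completable_covers[OF *(4,3) vs'(2,3)] by blast
      qed
    qed
    have "slice (pos v vs) (\<beta> v) t \<in> set rs"
      using Cons.prems(5) by (cases "\<beta> v") (auto simp: rs_def)
    then show ?thesis
      using run Close by (simp add: vs'_def)
  qed
qed

end

subsection \<open>Flows\<close>

definition net :: "(nat \<times> nat) list \<Rightarrow> (nat \<times> nat \<Rightarrow> 'g::ab_group_add) \<Rightarrow> nat \<Rightarrow> 'g" where
  "net es x v = (\<Sum>e\<in>set es. (if snd e = v then x e else 0) - (if fst e = v then x e else 0))"

text \<open>Since the edges are distinct, values chosen one after another fit together to one
  function.\<close>

lemma solvable_iff_net:
  assumes "distinct es"
  shows "solvable W es b \<beta> \<longleftrightarrow>
    (\<exists>x. (\<forall>e\<in>set es. x e \<noteq> 0) \<and> (\<forall>v\<in>W. b v + net es x v = \<beta> v))"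
  using assms
proof (induction es arbitrary: b)
  case Nil
  then show ?case
    by (simp add: net_def)
next
  case (Cons e es)
  obtain u w where e: "e = (u, w)"
    by fastforce
  have e_notin: "e \<notin> set es"
    using Cons.prems by simp
  have net_Cons: "net (e # es) x v = (if w = v then x e else 0) - (if u = v then x e else 0) + net es x v" for x :: "nat \<times> nat \<Rightarrow> 'a" and v
    using e_notin by (simp add: net_def e)
  have net_upd: "net es (x(e := y)) v = net es x v" for x :: "nat \<times> nat \<Rightarrow> 'a" and y v
    unfolding net_def using e_notin by (intro sum.cong) auto
  have "solvable W (e # es) b \<beta> \<longleftrightarrow> (\<exists>y x. y \<noteq> 0 \<and> (\<forall>e\<in>set es. x e \<noteq> 0) \<and>
      (\<forall>v\<in>W. b v + ((if w = v then y else 0) - (if u = v then y else 0)) + net es x v = \<beta> v))"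
    using Cons by (simp add: e)
  also have "\<dots> \<longleftrightarrow> (\<exists>x. (\<forall>e\<in>set (e # es). x e \<noteq> 0) \<and> (\<forall>v\<in>W. b v + net (e # es) x v = \<beta> v))"
    (is "?L \<longleftrightarrow> ?R")
  proof
    assume ?L
    then obtain y x where "y \<noteq> 0" "\<forall>e\<in>set es. x e \<noteq> 0"
      "\<forall>v\<in>W. b v + ((if w = v then y else 0) - (if u = v then y else 0)) + net es x v = \<beta> v"
      by blast
    then show ?R
      using e_notin by (intro exI[of _ "x(e := y)"]) (auto simp: net_Cons net_upd algebra_simps)
  next
    assume ?R
    then obtain x where "\<forall>e\<in>set (e # es). x e \<noteq> 0" "\<forall>v\<in>W. b v + net (e # es) x v = \<beta> v"
      by blast
    then show ?L
      by (intro exI[of _ "x e"] exI[of _ x]) (auto simp: net_Cons algebra_simps)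
  qed
  finally show ?case .
qed

section \<open>Graphs on an initial segment of the naturals\<close>

definition edge_sets :: "(nat \<times> nat) list \<Rightarrow> nat set set" where
  "edge_sets es = (\<lambda>(u, w). {u, w}) ` set es"

text \<open>Orienting every edge towards its larger end makes tail and head functions of the edge
  set alone, in agreement with the pairs in \<open>es\<close>.\<close>

definition upward :: "nat \<Rightarrow> (nat \<times> nat) list \<Rightarrow> (nat, nat set) pre_digraph" where
  "upward n es = \<lparr>verts = {..n}, arcs = edge_sets es, tail = Min, head = Max\<rparr>"

definition upward_edges :: "nat \<Rightarrow> (nat \<times> nat) list \<Rightarrow> bool" where
  "upward_edges n es \<longleftrightarrow> distinct es \<and> list_all (\<lambda>(u, w). u < w \<and> w \<le> n) es"

lemma upward_edges_simple:
  assumes "upward_edges n es"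
  shows "finite_simple_graph {..n} (edge_sets es)" "is_orientation {..n} (edge_sets es) (upward n es)"
proof -
  have e: "u < w" "u \<le> n" "w \<le> n" if "(u, w) \<in> set es" for u w
    using assms that by (auto simp: upward_edges_def list_all_iff)
  show "finite_simple_graph {..n} (edge_sets es)"
    unfolding finite_simple_graph_def
  proof (intro conjI ballI)
    show "finite {..n}"
      by simp
  next
    fix e assume "e \<in> edge_sets es"
    then obtain u w where uw: "e = {u, w}" "(u, w) \<in> set es"
      by (auto simp: edge_sets_def)
    then show "e \<subseteq> {..n}" "card e = 2"
      using e[OF uw(2)] by auto
  qed
  show "is_orientation {..n} (edge_sets es) (upward n es)"
    unfolding is_orientation_def
  proof (intro conjI ballI)
    fix e assume "e \<in> edge_sets es"
    then obtain u w where uw: "e = {u, w}" "(u, w) \<in> set es"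
      by (auto simp: edge_sets_def)
    then show "{tail (upward n es) e, head (upward n es) e} = e"
      using e(1)[OF uw(2)] by (simp add: upward_def)
  qed (simp_all add: upward_def)
qed

lemma is_flow_upward:
  assumes "upward_edges n es"
  shows "is_flow (upward n es) \<phi> \<longleftrightarrow> (\<forall>v\<in>{..n}. net es (\<lambda>(u, w). \<phi> {u, w}) v = 0)"
proof -
  have lt: "u < w" if "(u, w) \<in> set es" for u w
    using assms that by (auto simp: upward_edges_def list_all_iff)
  have inj: "inj_on (\<lambda>(u, w). {u, w}) (set es)"
  proof (rule inj_onI, clarify)
    fix u w u' w' assume *: "(u, w) \<in> set es" "(u', w') \<in> set es" "{u, w} = {u', w'}"
    then show "u = u' \<and> w = w'"
      using lt[OF *(1)] lt[OF *(2)] by (auto simp: doubleton_eq_iff)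
  qed
  have "(\<Sum>e\<in>in_arcs (upward n es) v. \<phi> e) - (\<Sum>e\<in>out_arcs (upward n es) v. \<phi> e) =
      net es (\<lambda>(u, w). \<phi> {u, w}) v" for v
  proof -
    have fin: "finite (edge_sets es)"
      by (simp add: edge_sets_def)
    have "(\<Sum>e\<in>in_arcs (upward n es) v. \<phi> e) - (\<Sum>e\<in>out_arcs (upward n es) v. \<phi> e) =
        (\<Sum>e\<in>edge_sets es. (if Max e = v then \<phi> e else 0) - (if Min e = v then \<phi> e else 0))"
      using fin by (simp add: in_arcs_def out_arcs_def upward_def sum_subtractf sum.inter_filter)
    also have "\<dots> = net es (\<lambda>(u, w). \<phi> {u, w}) v"
      unfolding edge_sets_def net_def sum.reindex[OF inj] o_def
    proof (rule sum.cong)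
      fix e assume "e \<in> set es"
      then have "fst e < snd e"
        using lt[of "fst e" "snd e"] by simp
      then show "(if Max (case e of (u, w) \<Rightarrow> {u, w}) = v then \<phi> (case e of (u, w) \<Rightarrow> {u, w}) else 0) -
          (if Min (case e of (u, w) \<Rightarrow> {u, w}) = v then \<phi> (case e of (u, w) \<Rightarrow> {u, w}) else 0) =
          (if snd e = v then case e of (u, w) \<Rightarrow> \<phi> {u, w} else 0) -
          (if fst e = v then case e of (u, w) \<Rightarrow> \<phi> {u, w} else 0)"
        by (cases e) simp
    qed simp
    finally show ?thesis .
  qed
  then show ?thesis
    unfolding is_flow_def by (simp add: upward_def) (metis eq_iff_diff_eq_0)
qed

text \<open>Each edge counts once at its head and once, negatively, at its tail.\<close>

lemma sum_net:
  assumes "upward_edges n es"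
  shows "(\<Sum>v\<in>{..n}. net es x v) = 0"
proof -
  have "\<And>e. e \<in> set es \<Longrightarrow> fst e \<in> {..n} \<and> snd e \<in> {..n}"
    using assms by (auto simp: upward_edges_def list_all_iff)
  then have "(\<Sum>v\<in>{..n}. (if snd e = v then x e else 0) - (if fst e = v then x e else 0)) = 0"
    if "e \<in> set es" for e
    using that by (simp add: sum_subtractf sum.delta)
  then show ?thesis
    unfolding net_def by (subst sum.swap) simp
qed

lemma net_diff: "net es (\<lambda>e. x e - y e) v = net es x v - net es y v"
  by (auto simp: net_def sum_subtractf[symmetric] intro!: sum.cong)

text \<open>Vertex \<open>n\<close> is the root, whose balance follows by \<open>sum_net\<close>.
  Forbidden values sit on edge sets in the definition but on ordered pairs here; \<open>flow\<close>
  relates any two functions that agree on the edges.\<close>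

lemma connected_iff_solvable:
  fixes T :: "'g::ab_group_add itself"
  assumes es: "upward_edges n es"
  shows "digraph_group_connected T (upward n es) \<longleftrightarrow>
    (\<forall>h :: nat \<times> nat \<Rightarrow> 'g. solvable ({..<n}) es (\<lambda>_. 0) (\<lambda>v. - net es h v))"
proof -
  have root: "(\<forall>v\<in>{..n}. net es x v = 0) \<longleftrightarrow> (\<forall>v\<in>{..<n}. net es x v = 0)" for x :: "nat \<times> nat \<Rightarrow> 'g"
  proof (intro iffI ballI)
    fix v assume 0: "\<forall>v\<in>{..<n}. net es x v = 0" and v: "v \<in> {..n}"
    have "net es x n = 0"
      using sum_net[OF es, of x] 0 by (simp add: lessThan_Suc_atMost[symmetric])
    then show "net es x v = 0"
      using 0 v by (cases "v = n") auto
  qed auto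
  have dist: "distinct es"
    using es by (simp add: upward_edges_def)
  have lt: "u < w" if "(u, w) \<in> set es" for u w
    using es that by (auto simp: upward_edges_def list_all_iff)
  have flow: "(\<exists>\<phi>. is_flow (upward n es) \<phi> \<and> (\<forall>e\<in>arcs (upward n es). \<phi> e \<noteq> h' e)) \<longleftrightarrow>
      solvable ({..<n}) es (\<lambda>_. 0) (\<lambda>v. - net es h v)"
    if h: "\<And>u w. (u, w) \<in> set es \<Longrightarrow> h (u, w) = h' {u, w}" for h and h' :: "nat set \<Rightarrow> 'g"
  proof
    assume "\<exists>\<phi>. is_flow (upward n es) \<phi> \<and> (\<forall>e\<in>arcs (upward n es). \<phi> e \<noteq> h' e)"
    then obtain \<phi> where "is_flow (upward n es) \<phi>" "\<forall>e\<in>edge_sets es. \<phi> e \<noteq> h' e"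
      by (auto simp: upward_def)
    then have \<phi>: "\<forall>v\<in>{..n}. net es (\<lambda>(u, w). \<phi> {u, w}) v = 0"
      "\<And>u w. (u, w) \<in> set es \<Longrightarrow> \<phi> {u, w} \<noteq> h' {u, w}"
      by (force simp: is_flow_upward[OF es] edge_sets_def)+
    show "solvable ({..<n}) es (\<lambda>_. 0) (\<lambda>v. - net es h v)"
      unfolding solvable_iff_net[OF dist]
    proof (intro exI conjI ballI)
      show "(case e of (u, w) \<Rightarrow> \<phi> {u, w}) - h e \<noteq> 0" if "e \<in> set es" for e
        using that \<phi>(2)[of "fst e" "snd e"] h[of "fst e" "snd e"] by (simp add: case_prod_beta)
      show "0 + net es (\<lambda>e. (case e of (u, w) \<Rightarrow> \<phi> {u, w}) - h e) v = - net es h v" if "v \<in> {..<n}" for v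
        using that \<phi>(1) by (simp add: net_diff)
    qed
  next
    assume "solvable ({..<n}) es (\<lambda>_. 0) (\<lambda>v. - net es h v)"
    then obtain x where x: "\<And>e. e \<in> set es \<Longrightarrow> x e \<noteq> 0"
      "\<And>v. v \<in> {..<n} \<Longrightarrow> net es x v = - net es h v"
      unfolding solvable_iff_net[OF dist] by auto
    \<comment> \<open>\<open>Min\<close> and \<open>Max\<close> recover the ordered pair; as
      \<open>x\<close> is nonzero, the sum avoids \<open>h'\<close>.\<close>
    define \<phi> where "\<phi> e = x (Min e, Max e) + h' e" for e
    have \<phi>: "\<phi> {u, w} = x (u, w) + h (u, w)" if "(u, w) \<in> set es" for u w
      using h[OF that] lt[OF that] by (simp add: \<phi>_def min_def max_def)
    have "net es (\<lambda>(u, w). \<phi> {u, w}) v = net es (\<lambda>e. x e - (- h e)) v" for v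
      unfolding net_def by (rule sum.cong) (auto simp: \<phi>)
    moreover have "net es (\<lambda>e. - h e) v = - net es h v" for v
      using net_diff[of es "\<lambda>_. 0" h v] by (simp add: net_def)
    ultimately have "\<forall>v\<in>{..<n}. net es (\<lambda>(u, w). \<phi> {u, w}) v = 0"
      using x(2) by (simp only: net_diff) simp
    moreover have "\<forall>e\<in>arcs (upward n es). \<phi> e \<noteq> h' e"
      using x(1) \<phi> h by (auto simp: upward_def edge_sets_def)
    ultimately show "\<exists>\<phi>. is_flow (upward n es) \<phi> \<and> (\<forall>e\<in>arcs (upward n es). \<phi> e \<noteq> h' e)"
      using is_flow_upward[OF es] root by blast
  qed
  show ?thesis
    unfolding digraph_group_connected_def
  proof (intro iffI allI)
    fix h :: "nat \<times> nat \<Rightarrow> 'g"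
    assume conn: "\<forall>h' :: nat set \<Rightarrow> 'g. \<exists>\<phi>. is_flow (upward n es) \<phi> \<and> (\<forall>e\<in>arcs (upward n es). \<phi> e \<noteq> h' e)"
    \<comment> \<open>This presents \<open>h\<close> as a function of the edge set.\<close>
    have *: "h (u, w) = h (Min {u, w}, Max {u, w})" if "(u, w) \<in> set es" for u w
      using lt[OF that] by (simp add: min_def max_def)
    show "solvable ({..<n}) es (\<lambda>_. 0) (\<lambda>v. - net es h v)"
    proof (subst flow[symmetric])
      show "h (u, w) = h (Min {u, w}, Max {u, w})" if "(u, w) \<in> set es" for u w
        using that by (rule *)
    qed (rule conn[rule_format])
  next
    fix h' :: "nat set \<Rightarrow> 'g"
    assume "\<forall>h :: nat \<times> nat \<Rightarrow> 'g. solvable ({..<n}) es (\<lambda>_. 0) (\<lambda>v. - net es h v)"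
    then show "\<exists>\<phi>. is_flow (upward n es) \<phi> \<and> (\<forall>e\<in>arcs (upward n es). \<phi> e \<noteq> h' e)"
      using flow[of "\<lambda>(u, w). h' {u, w}" h'] by auto
  qed
qed

text \<open>The boundary that a nowhere-zero function must have for its sum with the forbidden values to be
  a flow.\<close>

fun demand :: "(digit \<Rightarrow> digit \<Rightarrow> digit) \<Rightarrow> (nat \<times> nat) list \<Rightarrow> digit list \<Rightarrow> nat \<Rightarrow> digit" where
  "demand sub ((u, w) # es) (q # qs) v = (let r = demand sub es qs v in
     if v = w then sub r q else if v = u then sub r (sub D0 q) else r)"
| "demand sub _ _ v = D0"

text \<open>Some \<open>h\<close> with this boundary is enough for a refutation, whatever its values
  away from \<open>es\<close>.\<close>

lemma (in numbering) demand_net: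
  assumes "distinct es" "\<forall>(u, w)\<in>set es. u \<noteq> w" "length qs = length es"
  shows "\<exists>h. \<forall>v. val (demand sub es qs v) = - net es h v"
  using assms
proof (induction es arbitrary: qs)
  case Nil
  then show ?case
    by (simp add: net_def val_0)
next
  case (Cons e es)
  obtain u w where e: "e = (u, w)"
    by fastforce
  obtain q qs' where qs: "qs = q # qs'"
    using Cons.prems(3) by (cases qs) auto
  obtain h where h: "\<And>v. val (demand sub es qs' v) = - net es h v"
    using Cons qs by force
  have "net es (h(e := val q)) v = net es h v" for v
    unfolding net_def using Cons.prems(1) by (intro sum.cong) auto
  then have "net (e # es) (h(e := val q)) v =
      (if w = v then val q else 0) - (if u = v then val q else 0) + net es h v" for v
    using Cons.prems(1) by (simp add: net_def e)
  then have "val (demand sub (e # es) qs v) = - net (e # es) (h(e := val q)) v" for v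
    using Cons.prems(2) by (auto simp: e qs Let_def val_sub val_0 h simp del: fun_upd_apply)
  then show ?case
    by blast
qed

section \<open>From sweeps to graph connectivity\<close>

context numbering
begin

lemma connectedI:
  fixes T :: "'g itself"
  assumes "upward_edges n (edges p)" "valid p []" "opens p = [0..<n]"
    and "\<And>\<pi>. \<pi> \<in> set \<pi>s \<Longrightarrow> bij \<pi> \<and> (\<forall>p q. \<pi> (sub p q) = sub (\<pi> p) (\<pi> q))"
    and "check sub \<pi>s p cs [] [Full]"
  shows "graph_group_connected T {..n} (edge_sets (edges p))"
proof -
  have dist: "distinct (edges p)"
    using assms(1) by (simp add: upward_edges_def)
  have "solvable {..<n} (edges p) (\<lambda>_. 0) \<beta>" for \<beta> :: "nat \<Rightarrow> 'g"
  proof -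
    \<comment> \<open>With no vertex open, \<open>Full\<close> is the set of the empty vector, the
      state before any edge.\<close>
    have "run sub (\<lambda>v. inv val (\<beta> v)) p [] Full"
      using assms by (intro check_run[where ts = "[Full]"]) auto
    then have "completable p [] Full \<beta>"
      by (simp add: run_iff_completable[OF assms(2)])
    then obtain b where "\<forall>v\<in>{..<n}. b v = 0" "solvable {..<n} (edges p) b \<beta>"
      using assms(3) by (auto simp: completable_def reaches_def atLeast0LessThan)
    \<comment> \<open>\<open>b\<close> may be nonzero outside \<open>{..<n}\<close>, but solvability
      depends only on its values there.\<close>
    then show ?thesis
      by (simp add: solvable_iff_net[OF dist])
  qed
  then have "digraph_group_connected T (upward n (edges p))"
    by (simp add: connected_iff_solvable[OF assms(1)])
  then show ?thesis
    unfolding graph_group_connected_def using upward_edges_simple(2)[OF assms(1)] by blast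
qed

text \<open>Connectedness supplies some unknown orientation, so it is first carried over to
  \<open>upward\<close>. There one failing exact sweep contradicts it.\<close>

lemma not_connectedI:
  fixes T :: "'g itself"
  assumes "upward_edges n (edges p)" "valid p []" "opens p = [0..<n]"
    and "length qs = length (edges p)" "\<not> run sub (demand sub (edges p) qs) p [] Full"
  shows "\<not> graph_group_connected T {..n} (edge_sets (edges p))"
proof
  assume "graph_group_connected T {..n} (edge_sets (edges p))"
  then have "digraph_group_connected T (upward n (edges p))"
    unfolding graph_group_connected_def
    using digraph_group_connected_reorient upward_edges_simple[OF assms(1)] by blast
  then have solv: "solvable {..<n} (edges p) (\<lambda>_. 0) (\<lambda>v. - net (edges p) h v)"
    for h :: "nat \<times> nat \<Rightarrow> 'g"
    by (simp add: connected_iff_solvable[OF assms(1)])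
  have "distinct (edges p)" "\<forall>(u, w)\<in>set (edges p). u \<noteq> w"
    using assms(1) by (auto simp: upward_edges_def list_all_iff)
  then obtain h where "\<And>v. val (demand sub (edges p) qs v) = - net (edges p) h v"
    using demand_net assms(4) by blast
  then have "completable p [] Full (\<lambda>v. val (demand sub (edges p) qs v))"
    using solv[of h] assms(3)
    by (auto simp: completable_def reaches_def atLeast0LessThan intro!: exI[of _ "\<lambda>_. 0"])
  then show False
    using assms(5) by (simp add: run_iff_completable[OF assms(2)])
qed

end

subsection \<open>The two groups of order four\<close>

fun sub4 :: "digit \<Rightarrow> digit \<Rightarrow> digit" where
  "sub4 p D0 = p"
| "sub4 p D1 = (case p of D0 \<Rightarrow> D3 | D1 \<Rightarrow> D0 | D2 \<Rightarrow> D1 | D3 \<Rightarrow> D2)"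
| "sub4 p D2 = (case p of D0 \<Rightarrow> D2 | D1 \<Rightarrow> D3 | D2 \<Rightarrow> D0 | D3 \<Rightarrow> D1)"
| "sub4 p D3 = (case p of D0 \<Rightarrow> D1 | D1 \<Rightarrow> D2 | D2 \<Rightarrow> D3 | D3 \<Rightarrow> D0)"

text \<open>Bitwise exclusive or of two-bit numbers.\<close>

fun sub22 :: "digit \<Rightarrow> digit \<Rightarrow> digit" where
  "sub22 p D0 = p"
| "sub22 p D1 = (case p of D0 \<Rightarrow> D1 | D1 \<Rightarrow> D0 | D2 \<Rightarrow> D3 | D3 \<Rightarrow> D2)"
| "sub22 p D2 = (case p of D0 \<Rightarrow> D2 | D1 \<Rightarrow> D3 | D2 \<Rightarrow> D0 | D3 \<Rightarrow> D1)"
| "sub22 p D3 = (case p of D0 \<Rightarrow> D3 | D1 \<Rightarrow> D2 | D2 \<Rightarrow> D1 | D3 \<Rightarrow> D0)"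

definition val4 :: "digit \<Rightarrow> 4" where
  "val4 q = (case q of D0 \<Rightarrow> 0 | D1 \<Rightarrow> 1 | D2 \<Rightarrow> 2 | D3 \<Rightarrow> 3)"

definition val22 :: "digit \<Rightarrow> 2 \<times> 2" where
  "val22 q = (case q of D0 \<Rightarrow> (0, 0) | D1 \<Rightarrow> (0, 1) | D2 \<Rightarrow> (1, 0) | D3 \<Rightarrow> (1, 1))"

interpretation z4: numbering val4 sub4
proof
  show "bij val4"
    by (rule bij_digitI) (simp_all add: val4_def)
  fix p q show "val4 (sub4 p q) = val4 p - val4 q"
    by (cases p; cases q; simp add: val4_def)
qed (simp add: val4_def)

interpretation z22: numbering val22 sub22
proof
  show "bij val22"
    by (rule bij_digitI) (simp_all add: val22_def)
  fix p q show "val22 (sub22 p q) = val22 p - val22 q"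
    by (cases p; cases q; simp add: val22_def zero_prod_def)
qed (simp add: val22_def zero_prod_def)

definition perm :: "digit \<Rightarrow> digit \<Rightarrow> digit \<Rightarrow> digit \<Rightarrow> digit" where
  "perm a b c q = (case q of D0 \<Rightarrow> D0 | D1 \<Rightarrow> a | D2 \<Rightarrow> b | D3 \<Rightarrow> c)"

lemma bij_perm: "distinct [D0, a, b, c] \<Longrightarrow> bij (perm a b c)"
  by (rule bij_digitI) (simp_all add: perm_def UNIV_digit)

text \<open>Identity and negation, the only automorphisms of Z_4.\<close>

definition auts4 :: "(digit \<Rightarrow> digit) list" where
  "auts4 = [perm D1 D2 D3, perm D3 D2 D1]"

text \<open>Every permutation of the three nonzero elements of Z_2^2 is additive, as any two of them
  sum to the third.\<close>

definition auts22 :: "(digit \<Rightarrow> digit) list" where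
  "auts22 = [perm D1 D2 D3, perm D1 D3 D2, perm D2 D1 D3, perm D2 D3 D1, perm D3 D1 D2, perm D3 D2 D1]"

lemma auts4:
  assumes "\<pi> \<in> set auts4"
  shows "bij \<pi> \<and> (\<forall>p q. \<pi> (sub4 p q) = sub4 (\<pi> p) (\<pi> q))"
proof (intro conjI allI)
  show "bij \<pi>"
    using assms by (auto simp: auts4_def intro: bij_perm)
  show "\<pi> (sub4 p q) = sub4 (\<pi> p) (\<pi> q)" for p q
    using assms by (cases p; cases q) (auto simp: auts4_def perm_def)
qed

lemma auts22:
  assumes "\<pi> \<in> set auts22"
  shows "bij \<pi> \<and> (\<forall>p q. \<pi> (sub22 p q) = sub22 (\<pi> p) (\<pi> q))"
proof (intro conjI allI)
  show "bij \<pi>"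
    using assms by (auto simp: auts22_def intro: bij_perm)
  show "\<pi> (sub22 p q) = sub22 (\<pi> p) (\<pi> q)" for p q
    using assms by (cases p; cases q) (auto simp: auts22_def perm_def)
qed

subsection \<open>The two graphs\<close>

text \<open>A cubic graph on 12 vertices with three of its edges subdivided. This graph and the next one,
  the forbidden values and the witnesses were found by computer.\<close>

definition cubic12_program :: "step list" where
  "cubic12_program = [
    Open 0, Open 1, Edge 0 1, Open 2, Edge 0 2, Edge 2 14, Close 2, Open 3, Edge 0 3, Close 0,
    Open 4, Open 5, Edge 3 5, Edge 4 5, Close 5, Open 6, Edge 3 6, Close 3, Edge 1 6, Open 7,
    Edge 6 7, Close 6, Open 8, Edge 1 8, Close 1, Edge 4 7, Open 9, Edge 7 9, Close 7, Open 10,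
    Edge 8 10, Edge 9 10, Close 10, Open 11, Edge 8 11, Close 8, Open 12, Edge 4 12, Close 4,
    Open 13, Edge 9 13, Close 9, Edge 11 12, Edge 12 13, Close 12, Edge 13 14, Close 13, Edge 11 14,
    Close 11]"

text \<open>One inner list per closed vertex, in program order, with four entries for each set kept
  by the list before (one set at the start). The order of the sweep leaves at most three vertices
  open after a closing, so these sets lie among at most 64 vectors.\<close>

definition cubic12_witnesses :: "witness list list" where
  "cubic12_witnesses = [
    [
      Cover 0 0 [D0, D0], Keep, Cover 0 2 [D0, D0], Cover 0 3 [D0, D0]],
    [
      Keep, Cover 0 0 [D0, D0], Keep, Cover 1 0 [D0, D0]],
    [
      Cover 0 0 [D1, D0, D0], Keep, Keep, Cover 1 1 [D0, D0, D0], Cover 2 0 [D1, D0, D0], Keep,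
      Keep, Cover 3 1 [D0, D0, D0]],
    [
      Keep, Cover 0 0 [D0, D1, D0], Keep, Cover 1 0 [D0, D1, D0], Keep, Keep,
      Cover 2 0 [D0, D2, D0], Cover 3 0 [D0, D2, D0], Keep, Cover 4 0 [D0, D1, D0], Keep,
      Cover 5 0 [D0, D1, D0], Keep, Keep, Cover 6 0 [D0, D2, D0], Cover 7 0 [D0, D2, D0]],
    [
      Keep, Cover 0 0 [D0, D1, D1], Cover 5 0 [D0, D0, D0], Cover 5 0 [D0, D0, D0], Keep,
      Cover 1 0 [D0, D0, D0], Cover 5 0 [D0, D0, D2], Cover 5 0 [D0, D0, D2], Keep, Keep,
      Cover 4 0 [D0, D0, D0], Keep, Cover 2 0 [D0, D2, D3], Cover 2 0 [D0, D0, D1],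
      Cover 4 0 [D0, D0, D1], Cover 2 0 [D0, D2, D0], Keep, Cover 0 0 [D0, D0, D2], Keep,
      Cover 6 1 [D0, D0, D0], Cover 0 0 [D0, D0, D0], Cover 0 0 [D0, D0, D0],
      Cover 0 0 [D0, D0, D2], Cover 0 0 [D0, D0, D2], Cover 4 0 [D0, D0, D0],
      Cover 2 0 [D0, D2, D0], Cover 2 0 [D0, D2, D2], Cover 2 0 [D0, D0, D0],
      Cover 4 0 [D0, D0, D1], Cover 2 0 [D0, D2, D0], Cover 2 0 [D0, D2, D3], Cover 2 0 [D0, D0, D1]],
    [
      Keep, Keep, Cover 2 0 [D0, D0, D0], Cover 2 0 [D0, D0, D1], Keep, Cover 2 0 [D0, D0, D0],
      Keep, Cover 3 1 [D0, D0, D1], Keep, Cover 6 0 [D0, D0, D2], Keep, Keep, Keep,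
      Cover 6 0 [D0, D0, D2], Keep, Cover 6 0 [D0, D0, D0], Keep, Keep, Cover 9 0 [D0, D0, D2],
      Cover 10 0 [D0, D0, D2], Keep, Cover 11 0 [D0, D0, D1], Keep, Cover 12 0 [D0, D0, D1], Keep,
      Cover 13 0 [D0, D0, D1], Cover 2 0 [D0, D0, D0], Cover 2 0 [D0, D0, D1]],
    [
      Cover 4 0 [D0, D0, D3], Cover 25 0 [D0, D0, D0], Cover 7 1 [D0, D0, D2],
      Cover 7 0 [D0, D0, D3], Keep, Cover 4 0 [D0, D0, D2], Cover 7 1 [D0, D0, D2],
      Cover 7 0 [D0, D0, D3], Keep, Cover 7 0 [D0, D0, D2], Keep, Cover 2 1 [D0, D0, D1], Keep,
      Cover 10 0 [D0, D0, D2], Cover 7 1 [D0, D0, D2], Cover 7 0 [D0, D0, D2], Keep, Keep, Keep,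
      Keep, Keep, Cover 5 0 [D0, D0, D2], Keep, Keep, Keep, Keep, Cover 10 1 [D0, D0, D0], Keep,
      Keep, Cover 5 0 [D0, D0, D0], Keep, Keep, Keep, Cover 5 0 [D0, D0, D2], Keep, Keep, Keep,
      Keep, Cover 4 0 [D0, D0, D1], Cover 7 0 [D0, D0, D2], Keep, Keep, Cover 4 1 [D0, D0, D0],
      Cover 7 0 [D0, D0, D2], Keep, Cover 24 0 [D0, D0, D1], Keep, Cover 25 1 [D0, D0, D0],
      Cover 4 0 [D0, D0, D2], Cover 4 0 [D0, D0, D3], Cover 7 1 [D0, D0, D2],
      Cover 7 0 [D0, D0, D2], Keep, Cover 24 0 [D0, D0, D3], Cover 7 1 [D0, D0, D2], Keep],
    [
      Cover 0 0 [D0, D2, D0], Cover 0 0 [D0, D2, D0], Cover 10 0 [D2, D1, D0],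
      Cover 10 1 [D3, D1, D0], Cover 0 0 [D0, D0, D0], Keep, Keep, Cover 1 1 [D1, D0, D1],
      Cover 0 0 [D0, D2, D0], Cover 0 0 [D0, D2, D0], Cover 11 1 [D3, D0, D1],
      Cover 25 0 [D0, D0, D0], Cover 0 0 [D2, D0, D0], Cover 0 0 [D0, D2, D0],
      Cover 10 0 [D2, D1, D0], Cover 25 0 [D0, D0, D0], Cover 7 1 [D0, D0, D3],
      Cover 22 0 [D1, D2, D3], Keep, Keep, Cover 7 0 [D1, D0, D2], Cover 7 0 [D0, D0, D2], Keep,
      Keep, Cover 8 0 [D2, D0, D1], Keep, Cover 8 0 [D0, D0, D1], Cover 8 1 [D0, D1, D1],
      Cover 7 0 [D1, D0, D0], Keep, Keep, Cover 8 1 [D0, D1, D0], Cover 8 0 [D2, D0, D1],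
      Cover 22 0 [D1, D2, D1], Cover 2 0 [D0, D0, D2], Keep, Cover 7 0 [D1, D0, D3],
      Cover 7 0 [D0, D0, D3], Cover 8 0 [D0, D0, D3], Cover 25 0 [D3, D0, D1],
      Cover 7 0 [D1, D0, D2], Cover 7 0 [D0, D0, D2], Keep, Keep, Cover 0 0 [D1, D0, D2],
      Cover 0 0 [D0, D0, D2], Keep, Keep, Cover 0 0 [D1, D0, D2], Cover 0 0 [D0, D0, D2],
      Cover 8 0 [D0, D1, D0], Cover 5 0 [D0, D0, D2], Cover 7 0 [D0, D2, D0],
      Cover 7 0 [D0, D0, D2], Cover 25 1 [D2, D0, D1], Keep, Cover 7 0 [D0, D0, D2],
      Cover 22 0 [D1, D2, D3], Cover 12 0 [D0, D0, D2], Keep, Cover 0 0 [D2, D2, D2],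
      Cover 7 1 [D0, D0, D0], Cover 8 0 [D0, D0, D0], Cover 8 1 [D0, D1, D0],
      Cover 7 0 [D1, D0, D0], Cover 7 0 [D0, D0, D0], Keep, Keep, Cover 10 1 [D1, D1, D0],
      Cover 22 0 [D1, D2, D1], Cover 12 0 [D0, D0, D0], Cover 12 1 [D1, D0, D1],
      Cover 0 0 [D1, D0, D0], Cover 0 0 [D0, D0, D0], Cover 8 0 [D0, D0, D3],
      Cover 25 0 [D3, D0, D1], Cover 7 0 [D1, D0, D2], Cover 7 0 [D0, D0, D2], Keep, Keep,
      Cover 7 0 [D2, D0, D2], Cover 7 0 [D2, D0, D2], Cover 12 0 [D0, D0, D0],
      Cover 25 0 [D3, D0, D3], Cover 7 0 [D2, D0, D2], Cover 7 0 [D2, D0, D2],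
      Cover 21 0 [D0, D0, D0], Keep, Cover 0 0 [D3, D0, D0], Cover 7 0 [D2, D0, D2], Keep,
      Cover 10 1 [D3, D1, D1], Cover 0 0 [D2, D0, D0], Cover 7 0 [D2, D0, D2],
      Cover 25 1 [D0, D0, D1], Cover 5 0 [D0, D0, D2], Cover 22 0 [D1, D0, D0], Keep, Keep,
      Cover 23 1 [D0, D0, D0], Cover 8 1 [D0, D1, D2], Cover 22 0 [D0, D0, D2], Keep, Keep,
      Cover 0 0 [D0, D2, D0], Cover 0 0 [D0, D2, D0], Cover 10 0 [D2, D1, D0],
      Cover 11 0 [D2, D0, D1], Cover 8 0 [D2, D0, D3], Keep, Cover 8 0 [D0, D0, D3],
      Cover 12 1 [D1, D0, D3]],
    [
      Keep, Cover 0 0 [D0, D1, D0], Keep, Cover 1 0 [D0, D1, D0], Keep, Cover 1 0 [D0, D0, D0],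
      Cover 2 0 [D0, D2, D0], Cover 1 0 [D0, D2, D0], Keep, Keep, Cover 3 0 [D0, D2, D0],
      Cover 4 0 [D0, D2, D0], Keep, Keep, Cover 6 0 [D0, D3, D0], Cover 5 0 [D0, D3, D0], Keep,
      Keep, Cover 7 0 [D0, D2, D0], Cover 8 0 [D0, D2, D0], Keep, Keep, Cover 10 0 [D0, D3, D0],
      Cover 9 0 [D0, D3, D0], Keep, Cover 11 0 [D0, D1, D0], Cover 40 0 [D0, D2, D3],
      Cover 40 0 [D0, D3, D3], Keep, Cover 12 0 [D0, D1, D0], Keep, Cover 13 0 [D0, D1, D0], Keep,
      Keep, Cover 14 0 [D0, D2, D0], Cover 15 0 [D0, D2, D0], Keep, Cover 16 1 [D0, D1, D0],
      Cover 16 1 [D0, D2, D0], Cover 16 0 [D0, D3, D0], Keep, Keep, Cover 17 0 [D0, D2, D0],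
      Cover 18 0 [D0, D2, D0], Keep, Cover 12 0 [D0, D3, D2], Cover 12 0 [D0, D0, D2],
      Cover 19 0 [D0, D3, D0], Keep, Keep, Cover 20 0 [D0, D2, D0], Cover 21 0 [D0, D2, D0], Keep,
      Keep, Cover 23 0 [D0, D3, D0], Cover 22 0 [D0, D3, D0], Keep, Cover 12 0 [D0, D1, D0],
      Cover 12 0 [D0, D2, D0], Cover 24 0 [D0, D3, D0], Keep, Keep, Cover 26 0 [D0, D3, D0],
      Cover 25 0 [D0, D3, D0], Keep, Keep, Cover 27 0 [D0, D2, D0], Cover 28 0 [D0, D2, D0], Keep,
      Cover 12 0 [D0, D3, D0], Cover 12 0 [D0, D0, D0], Cover 29 0 [D0, D3, D0], Keep, Keep,
      Cover 30 0 [D0, D2, D0], Cover 31 0 [D0, D2, D0], Keep, Cover 12 0 [D0, D3, D2],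
      Cover 12 0 [D0, D0, D2], Cover 32 0 [D0, D3, D0], Keep, Keep, Cover 34 0 [D0, D3, D0],
      Cover 33 0 [D0, D3, D0], Keep, Keep, Cover 35 0 [D0, D2, D0], Cover 36 0 [D0, D2, D0], Keep,
      Cover 37 0 [D0, D1, D0], Keep, Cover 38 0 [D0, D1, D0], Keep, Cover 38 0 [D0, D0, D0],
      Cover 39 0 [D0, D2, D0], Cover 38 0 [D0, D2, D0], Keep, Cover 11 0 [D0, D1, D3],
      Cover 40 0 [D0, D2, D0], Cover 11 0 [D0, D3, D3], Keep, Keep, Cover 42 0 [D0, D3, D0],
      Cover 41 0 [D0, D3, D0], Keep, Cover 43 0 [D0, D1, D0], Keep, Cover 44 0 [D0, D1, D0]],
    [
      Keep, Cover 0 1 [D0, D0, D0], Cover 13 0 [D0, D0, D0], Cover 13 0 [D0, D0, D0], Keep,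
      Cover 1 1 [D0, D0, D1], Cover 15 0 [D0, D0, D0], Cover 1 0 [D3, D0, D0], Keep, Keep,
      Cover 13 0 [D0, D0, D2], Cover 13 0 [D0, D0, D2], Keep, Cover 17 0 [D0, D0, D0],
      Cover 17 0 [D3, D0, D0], Cover 11 1 [D0, D0, D0], Keep, Cover 56 1 [D0, D0, D2],
      Cover 30 0 [D0, D0, D2], Cover 10 1 [D0, D0, D0], Cover 20 1 [D2, D0, D2],
      Cover 21 1 [D0, D0, D0], Cover 56 0 [D0, D0, D1], Keep, Cover 17 1 [D2, D0, D2],
      Cover 14 0 [D3, D0, D0], Cover 14 0 [D0, D0, D0], Keep, Keep, Cover 18 0 [D0, D0, D0],
      Cover 7 1 [D0, D0, D0], Cover 18 0 [D2, D0, D0], Keep, Cover 21 0 [D0, D0, D0],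
      Cover 6 1 [D0, D0, D0], Cover 21 0 [D2, D0, D0], Cover 21 1 [D3, D0, D3],
      Cover 56 0 [D0, D0, D3], Keep, Cover 30 1 [D0, D0, D3], Cover 18 1 [D3, D0, D3],
      Cover 14 1 [D2, D0, D0], Keep, Cover 14 1 [D0, D0, D0], Cover 13 0 [D1, D0, D0],
      Cover 13 0 [D0, D0, D0], Cover 14 1 [D2, D0, D3], Keep, Keep, Cover 13 0 [D1, D0, D0], Keep,
      Cover 14 1 [D0, D0, D1], Keep, Cover 30 0 [D0, D0, D2], Keep, Cover 20 1 [D0, D0, D0],
      Cover 13 0 [D1, D0, D2], Cover 13 0 [D0, D0, D2], Keep, Keep, Keep, Cover 30 0 [D0, D0, D2],
      Keep, Keep, Cover 56 0 [D0, D0, D1], Cover 28 0 [D0, D0, D0], Keep, Keep, Keep,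
      Cover 18 0 [D0, D0, D0], Cover 13 0 [D0, D0, D3], Cover 13 0 [D1, D0, D3], Keep,
      Cover 21 0 [D0, D0, D0], Keep, Cover 30 0 [D0, D0, D2], Keep, Cover 56 0 [D0, D0, D3], Keep,
      Cover 30 1 [D0, D0, D3], Keep, Cover 56 1 [D0, D0, D0], Keep, Keep, Keep,
      Cover 14 1 [D0, D0, D1], Keep, Cover 14 1 [D2, D0, D1], Cover 6 0 [D0, D0, D1],
      Cover 56 0 [D0, D0, D0], Cover 23 0 [D0, D0, D1], Cover 38 1 [D2, D0, D3],
      Cover 7 0 [D0, D0, D1], Cover 14 0 [D0, D0, D1], Cover 14 0 [D3, D0, D1],
      Cover 56 0 [D0, D0, D3], Keep, Cover 30 1 [D0, D0, D0], Cover 13 0 [D0, D0, D2],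
      Cover 13 0 [D1, D0, D2], Keep, Cover 56 0 [D0, D0, D3], Cover 56 0 [D0, D0, D1],
      Cover 20 1 [D2, D0, D0], Keep, Cover 14 0 [D3, D0, D0], Cover 14 0 [D0, D0, D0],
      Cover 20 1 [D2, D0, D0], Cover 13 0 [D0, D0, D2], Cover 13 0 [D1, D0, D2], Keep,
      Cover 21 0 [D0, D0, D0], Cover 19 0 [D1, D0, D0], Cover 30 0 [D0, D0, D2], Keep,
      Cover 21 0 [D0, D0, D0], Cover 19 1 [D1, D0, D0], Cover 30 1 [D0, D0, D3], Keep,
      Cover 20 1 [D0, D0, D0], Keep, Cover 21 0 [D2, D0, D2], Cover 13 0 [D0, D0, D3],
      Cover 13 0 [D1, D0, D3], Keep, Cover 21 0 [D0, D0, D0], Keep, Cover 30 0 [D0, D0, D2], Keep,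
      Cover 30 1 [D0, D0, D1], Keep, Cover 30 1 [D0, D0, D3], Cover 21 1 [D3, D0, D0],
      Cover 30 1 [D0, D0, D3], Keep, Cover 30 1 [D0, D0, D0], Cover 21 1 [D3, D0, D0],
      Cover 14 1 [D0, D0, D0], Keep, Cover 14 1 [D2, D0, D0], Cover 30 0 [D0, D0, D2],
      Cover 21 0 [D2, D0, D0], Keep, Cover 56 1 [D0, D0, D2], Cover 20 0 [D3, D0, D0],
      Cover 14 1 [D0, D0, D0], Keep, Cover 14 1 [D2, D0, D0], Cover 54 0 [D0, D0, D3], Keep, Keep,
      Cover 50 1 [D0, D0, D0], Keep, Keep, Keep, Cover 53 1 [D0, D0, D1], Keep,
      Cover 30 0 [D0, D0, D0], Cover 56 1 [D0, D0, D0], Cover 27 1 [D0, D0, D2], Keep,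
      Cover 23 1 [D0, D0, D2], Cover 54 0 [D0, D0, D0], Cover 27 1 [D0, D0, D0],
      Cover 21 1 [D0, D0, D3], Keep, Keep, Cover 30 1 [D0, D0, D0], Cover 18 1 [D0, D0, D3], Keep,
      Cover 13 0 [D1, D0, D1], Cover 13 0 [D0, D0, D1], Keep, Keep, Cover 13 0 [D0, D0, D0],
      Cover 13 0 [D0, D0, D0], Keep, Keep, Cover 28 0 [D0, D0, D0], Cover 28 1 [D0, D0, D1]],
    [
      Cover 25 0 [D3, D3, D1], Cover 25 0 [D3, D3, D0], Cover 25 0 [D0, D3, D0],
      Cover 25 0 [D0, D3, D1], Keep, Keep, Cover 40 1 [D0, D0, D0], Cover 40 1 [D0, D0, D0],
      Cover 25 0 [D3, D0, D0], Cover 25 0 [D3, D0, D0], Cover 25 0 [D0, D0, D0],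
      Cover 25 0 [D0, D0, D0], Cover 25 1 [D2, D0, D1], Cover 25 1 [D2, D0, D1],
      Cover 25 1 [D0, D0, D1], Cover 25 1 [D0, D0, D1], Keep, Cover 25 0 [D3, D0, D0],
      Cover 25 0 [D0, D0, D0], Cover 25 1 [D0, D0, D1], Cover 34 0 [D0, D0, D3],
      Cover 25 0 [D3, D0, D1], Cover 25 0 [D0, D0, D1], Cover 25 1 [D0, D0, D1],
      Cover 42 0 [D0, D0, D0], Keep, Cover 11 1 [D0, D0, D2], Keep, Cover 24 1 [D0, D0, D0],
      Cover 0 1 [D0, D2, D0], Cover 1 1 [D3, D2, D0], Cover 0 1 [D2, D2, D0],
      Cover 25 0 [D3, D0, D0], Cover 9 0 [D0, D1, D0], Cover 25 1 [D0, D0, D1],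
      Cover 25 0 [D0, D0, D0], Cover 25 0 [D3, D0, D0], Keep, Cover 25 1 [D0, D0, D0],
      Cover 25 0 [D0, D0, D0], Keep, Cover 24 0 [D0, D0, D0], Cover 19 0 [D0, D3, D0], Keep,
      Cover 40 1 [D1, D3, D3], Cover 40 1 [D0, D3, D3], Cover 40 1 [D0, D3, D0],
      Cover 40 1 [D1, D3, D0], Cover 42 0 [D2, D0, D2], Cover 30 1 [D3, D0, D3],
      Cover 40 0 [D0, D0, D2], Cover 40 0 [D1, D0, D2], Keep, Keep, Keep, Cover 10 1 [D0, D1, D0],
      Keep, Keep, Cover 40 1 [D1, D0, D3], Cover 40 1 [D0, D0, D3], Keep, Cover 13 1 [D0, D1, D0],
      Cover 31 0 [D1, D0, D0], Cover 10 0 [D0, D0, D3], Cover 25 0 [D3, D0, D0],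
      Cover 25 0 [D3, D0, D0], Cover 25 0 [D0, D0, D0], Cover 25 0 [D0, D0, D0],
      Cover 25 0 [D3, D0, D0], Cover 40 1 [D1, D0, D3], Keep, Cover 25 0 [D0, D0, D0],
      Cover 40 0 [D1, D0, D2], Cover 25 1 [D2, D0, D1], Cover 40 0 [D1, D0, D0],
      Cover 25 1 [D0, D0, D1], Keep, Cover 15 0 [D0, D1, D0], Cover 10 0 [D0, D1, D3],
      Cover 10 0 [D0, D0, D3], Cover 25 0 [D3, D0, D0], Keep, Cover 40 1 [D0, D0, D0],
      Cover 25 0 [D0, D0, D0], Keep, Cover 25 1 [D2, D0, D1], Keep, Cover 25 1 [D0, D0, D1],
      Cover 25 1 [D2, D0, D0], Cover 40 0 [D0, D2, D0], Cover 25 1 [D0, D0, D0],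
      Cover 11 1 [D0, D2, D2], Cover 22 0 [D0, D3, D0], Cover 25 0 [D3, D0, D1],
      Cover 25 0 [D0, D0, D1], Keep, Cover 25 0 [D0, D3, D1], Cover 40 1 [D1, D0, D3], Keep,
      Cover 25 0 [D3, D3, D1], Cover 25 0 [D0, D3, D0], Keep, Cover 40 1 [D0, D0, D0],
      Cover 25 0 [D3, D3, D0], Cover 34 0 [D3, D0, D3], Cover 25 0 [D3, D3, D1],
      Cover 25 0 [D0, D3, D1], Cover 40 1 [D0, D3, D0], Cover 19 0 [D0, D3, D0],
      Cover 25 0 [D0, D3, D1], Cover 25 0 [D3, D3, D1], Keep, Keep, Keep, Cover 19 0 [D0, D3, D0],
      Cover 10 1 [D0, D1, D2], Cover 25 0 [D3, D3, D0], Cover 25 1 [D2, D2, D1],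
      Cover 7 1 [D0, D1, D0], Cover 25 0 [D0, D3, D0], Cover 40 1 [D0, D3, D0],
      Cover 25 0 [D3, D0, D0], Keep, Cover 25 1 [D0, D0, D1], Cover 25 0 [D3, D0, D0],
      Cover 22 1 [D0, D2, D0], Cover 25 1 [D0, D0, D1], Cover 25 0 [D0, D0, D0],
      Cover 25 0 [D3, D3, D1], Cover 25 1 [D2, D2, D0], Cover 2 0 [D0, D0, D0],
      Cover 25 0 [D0, D3, D1], Keep, Cover 25 0 [D3, D0, D1], Cover 25 0 [D0, D0, D1],
      Cover 25 1 [D0, D0, D0], Cover 40 0 [D1, D2, D0], Cover 25 0 [D0, D3, D0],
      Cover 25 0 [D3, D3, D0], Cover 40 1 [D1, D0, D0], Cover 25 1 [D2, D0, D0],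
      Cover 40 0 [D0, D2, D0], Cover 25 1 [D0, D0, D0], Keep, Cover 25 1 [D2, D0, D1],
      Cover 24 1 [D0, D0, D3], Cover 25 1 [D0, D0, D1], Cover 40 0 [D1, D2, D2],
      Cover 25 0 [D0, D3, D1], Cover 40 1 [D1, D0, D3], Cover 0 0 [D3, D0, D0],
      Cover 25 0 [D3, D3, D1], Cover 25 0 [D0, D3, D0], Cover 1 0 [D0, D0, D0],
      Cover 40 1 [D0, D0, D0], Cover 25 0 [D3, D3, D0], Cover 25 0 [D3, D0, D1],
      Cover 25 0 [D0, D3, D1], Cover 25 0 [D3, D3, D1], Cover 25 0 [D0, D0, D1],
      Cover 25 0 [D0, D3, D1], Cover 40 1 [D0, D3, D0], Keep, Cover 25 0 [D3, D3, D1],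
      Cover 25 0 [D0, D3, D0], Cover 8 0 [D0, D0, D0], Cover 40 1 [D0, D0, D0],
      Cover 25 0 [D3, D3, D0], Keep, Cover 1 0 [D0, D3, D0], Cover 40 1 [D0, D3, D0],
      Cover 40 1 [D1, D3, D0], Cover 19 0 [D0, D3, D0], Cover 25 0 [D0, D3, D1],
      Cover 25 0 [D3, D3, D1], Cover 22 0 [D0, D0, D0], Cover 25 0 [D3, D3, D1], Keep, Keep,
      Cover 25 0 [D0, D3, D1], Keep, Cover 25 0 [D0, D3, D1], Cover 25 0 [D3, D3, D1], Keep,
      Cover 40 1 [D1, D3, D0], Cover 25 0 [D0, D3, D0], Cover 25 0 [D3, D3, D0],
      Cover 40 1 [D1, D3, D3], Cover 32 0 [D1, D0, D1], Cover 25 1 [D0, D2, D1], Keep,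
      Cover 25 1 [D2, D2, D1], Cover 0 0 [D3, D3, D0], Cover 25 1 [D0, D2, D0],
      Cover 26 0 [D0, D0, D2], Cover 25 1 [D2, D2, D0], Cover 25 0 [D3, D3, D1],
      Cover 25 0 [D3, D3, D0], Cover 25 0 [D0, D3, D0], Cover 25 0 [D0, D3, D1],
      Cover 25 0 [D3, D0, D1], Cover 25 0 [D3, D0, D0], Cover 25 0 [D0, D0, D0],
      Cover 25 0 [D0, D0, D1], Keep, Cover 35 1 [D0, D0, D0], Cover 40 0 [D1, D2, D2],
      Cover 40 0 [D0, D2, D2], Keep, Cover 36 1 [D0, D0, D0], Cover 40 0 [D0, D2, D2],
      Cover 40 0 [D1, D2, D2], Cover 30 1 [D3, D0, D3], Cover 42 0 [D2, D0, D2],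
      Cover 40 0 [D1, D0, D2], Cover 40 0 [D0, D0, D2], Cover 40 1 [D1, D3, D0],
      Cover 40 1 [D0, D3, D0], Cover 35 0 [D0, D0, D3], Keep, Keep, Cover 22 1 [D0, D0, D0],
      Cover 30 1 [D3, D0, D0], Keep, Keep, Cover 25 1 [D2, D2, D0], Keep, Cover 25 1 [D0, D2, D0],
      Cover 31 0 [D0, D1, D0], Cover 11 1 [D0, D0, D2], Cover 41 0 [D3, D0, D0], Keep,
      Cover 40 1 [D1, D0, D0], Cover 25 1 [D2, D2, D1], Cover 40 0 [D1, D0, D2],
      Cover 25 1 [D0, D2, D1], Cover 29 0 [D0, D0, D0], Cover 30 0 [D0, D0, D0],
      Cover 40 0 [D1, D0, D2], Cover 40 0 [D0, D0, D2], Cover 24 1 [D0, D0, D0],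
      Cover 34 1 [D2, D0, D2], Cover 40 0 [D1, D0, D2], Cover 40 0 [D0, D0, D2],
      Cover 25 0 [D3, D0, D1], Cover 25 0 [D3, D0, D0], Cover 25 0 [D0, D0, D0],
      Cover 25 0 [D0, D0, D1], Cover 25 0 [D3, D0, D0], Cover 25 0 [D3, D0, D1],
      Cover 25 0 [D0, D0, D1], Cover 25 0 [D0, D0, D0]],
    [
      Cover 2 0 [D2, D0], Cover 0 0 [D3, D0], Keep, Cover 0 1 [D0, D1], Cover 0 0 [D3, D0],
      Cover 0 0 [D3, D1], Cover 0 0 [D0, D0], Cover 0 1 [D0, D1], Cover 0 0 [D3, D0],
      Cover 0 0 [D3, D0], Cover 0 0 [D0, D1], Cover 0 0 [D3, D2], Cover 0 0 [D0, D0],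
      Cover 0 1 [D0, D1], Cover 2 0 [D2, D0], Cover 0 0 [D3, D0], Cover 0 0 [D2, D0],
      Cover 0 0 [D3, D0], Cover 0 0 [D0, D0], Cover 0 0 [D1, D0], Cover 0 1 [D2, D0],
      Cover 0 0 [D2, D1], Cover 0 0 [D1, D1], Cover 2 0 [D1, D0], Cover 0 1 [D0, D1],
      Cover 0 0 [D0, D0], Cover 0 0 [D3, D0], Cover 2 0 [D2, D0], Cover 0 0 [D2, D0],
      Cover 0 0 [D3, D0], Cover 0 0 [D0, D0], Cover 0 0 [D1, D0], Cover 0 1 [D2, D1],
      Cover 0 0 [D3, D1], Cover 0 0 [D0, D0], Cover 2 0 [D2, D2], Cover 0 0 [D3, D1],
      Cover 0 1 [D2, D1], Cover 2 0 [D2, D2], Cover 0 0 [D0, D0], Cover 0 0 [D0, D0],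
      Cover 1 0 [D0, D0], Cover 0 0 [D2, D0], Cover 0 0 [D3, D0], Cover 0 1 [D0, D1], Keep,
      Cover 0 0 [D2, D0], Cover 2 0 [D0, D2], Cover 1 1 [D1, D0], Cover 0 0 [D0, D0],
      Cover 0 0 [D3, D0], Cover 0 0 [D2, D0], Cover 0 0 [D0, D0], Cover 0 0 [D0, D0],
      Cover 0 0 [D3, D0], Cover 0 0 [D3, D1], Cover 2 0 [D1, D0], Cover 0 0 [D0, D0],
      Cover 0 0 [D2, D0], Cover 0 0 [D2, D0], Cover 0 0 [D0, D1], Cover 0 1 [D0, D0],
      Cover 2 0 [D3, D0], Cover 0 0 [D3, D1], Cover 0 1 [D2, D0], Cover 0 0 [D2, D1],
      Cover 0 0 [D1, D1], Cover 2 0 [D1, D0], Cover 0 0 [D3, D1], Cover 0 1 [D3, D0], Keep,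
      Cover 0 0 [D0, D1], Cover 2 0 [D0, D0], Cover 0 0 [D0, D1], Cover 0 0 [D3, D1],
      Cover 0 1 [D3, D0], Cover 2 0 [D1, D1], Cover 0 0 [D1, D0], Cover 0 0 [D2, D0],
      Cover 0 1 [D2, D1], Cover 0 0 [D0, D1], Cover 0 0 [D0, D0], Cover 0 0 [D3, D0],
      Cover 0 0 [D2, D0], Cover 0 1 [D0, D2], Cover 0 0 [D2, D1], Cover 0 0 [D1, D1],
      Cover 2 0 [D1, D0], Cover 2 0 [D1, D1], Cover 0 0 [D1, D0], Cover 0 0 [D2, D0],
      Cover 0 1 [D2, D1], Cover 0 1 [D0, D1], Cover 0 0 [D0, D0], Cover 0 0 [D3, D0],
      Cover 2 0 [D2, D0], Cover 1 0 [D2, D2], Cover 0 1 [D0, D1], Cover 2 0 [D2, D0],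
      Cover 0 0 [D3, D0], Cover 2 0 [D1, D0], Cover 0 0 [D3, D2], Cover 0 0 [D0, D3],
      Cover 0 1 [D1, D3], Cover 0 1 [D3, D1], Cover 0 0 [D3, D0], Cover 0 0 [D0, D0],
      Cover 2 0 [D1, D0], Cover 0 0 [D1, D0], Cover 0 0 [D0, D0], Cover 0 0 [D3, D1],
      Cover 0 0 [D3, D0], Cover 2 0 [D1, D0], Cover 0 0 [D0, D0], Cover 0 0 [D3, D0],
      Cover 0 1 [D3, D1], Cover 0 0 [D0, D1], Cover 0 0 [D0, D1], Cover 0 0 [D3, D0],
      Cover 0 0 [D2, D0], Cover 1 1 [D3, D2], Cover 0 0 [D1, D0], Cover 0 0 [D2, D0],
      Cover 0 0 [D3, D0], Cover 0 0 [D3, D0], Cover 0 0 [D2, D0], Cover 0 0 [D1, D0],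
      Cover 1 0 [D2, D2], Cover 0 0 [D2, D0], Cover 0 0 [D2, D0], Cover 0 0 [D1, D0],
      Cover 0 0 [D2, D2], Cover 0 1 [D2, D3], Cover 0 0 [D1, D0], Cover 0 0 [D2, D0],
      Cover 0 0 [D2, D0], Cover 0 0 [D0, D1], Cover 0 1 [D3, D3], Cover 2 0 [D1, D2],
      Cover 0 0 [D3, D0], Cover 0 0 [D3, D1], Cover 0 1 [D2, D1], Cover 2 0 [D3, D3],
      Cover 0 0 [D0, D0], Cover 0 1 [D2, D0], Cover 0 0 [D3, D0], Cover 0 0 [D0, D0],
      Cover 1 0 [D0, D0], Cover 1 1 [D3, D3], Cover 0 0 [D0, D1], Cover 0 0 [D3, D1],
      Cover 2 0 [D3, D0], Cover 2 0 [D1, D0], Cover 0 0 [D1, D1], Cover 0 0 [D2, D1],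
      Cover 0 1 [D2, D0], Cover 0 1 [D2, D0], Cover 0 0 [D2, D1], Cover 1 0 [D2, D3],
      Cover 2 0 [D1, D0], Cover 2 0 [D1, D0], Cover 1 0 [D2, D2], Cover 1 0 [D2, D1],
      Cover 1 1 [D2, D0], Cover 0 0 [D3, D0], Cover 0 1 [D3, D1], Cover 2 0 [D1, D0],
      Cover 0 0 [D0, D0], Cover 0 1 [D0, D1], Cover 1 0 [D2, D2], Cover 0 0 [D3, D0],
      Cover 2 0 [D2, D0]],
    [
      Keep, Cover 0 0 [D2], Cover 0 0 [D2], Cover 0 0 [D2], Cover 0 0 [D0], Cover 0 0 [D0],
      Cover 0 3 [D1], Cover 0 0 [D0], Cover 0 0 [D2], Cover 0 0 [D2], Cover 0 0 [D2], Cover 0 0 [D2]],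
    [
      Keep, Cover 0 0 [], Cover 0 0 [], Cover 0 0 []]]"

text \<open>One value per edge in program order, each edge directed to its larger end. On the
  subdivided edges from 0 to 14, 3 to 4 and 8 to 9 they bar {0,3}, {0,2} and {0,3}, so both kinds of
  pairs in Z_4 occur.\<close>

definition cubic12_forbidden :: "digit list" where
  "cubic12_forbidden = [
    D1, D0, D3, D0, D0, D2, D0, D2, D2, D1, D0, D1, D3, D0, D2, D0, D0, D0, D0, D0, D0]"

lemma cubic12_program: "upward_edges 14 (edges cubic12_program)" "valid cubic12_program []"
  "opens cubic12_program = [0..<14]"
  by code_simp+

lemma cubic12_connected: "graph_group_connected TYPE(2 \<times> 2) {..14} (edge_sets (edges cubic12_program))"
proof (rule z22.connectedI[OF cubic12_program auts22])
  show "check sub22 auts22 cubic12_program cubic12_witnesses [] [Full]"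
    by code_simp
qed

lemma cubic12_not_connected:
  "\<not> graph_group_connected TYPE(4) {..14} (edge_sets (edges cubic12_program))"
proof (rule z4.not_connectedI[OF cubic12_program])
  show "length cubic12_forbidden = length (edges cubic12_program)"
    by code_simp
  show "\<not> run sub4 (demand sub4 (edges cubic12_program) cubic12_forbidden) cubic12_program [] Full"
    by code_simp
qed

text \<open>The cube with three of its edges subdivided.\<close>

definition cube_program :: "step list" where
  "cube_program = [
    Open 0, Open 1, Open 2, Edge 0 2, Edge 1 2, Close 2, Open 3, Edge 0 3, Open 4, Edge 0 4,
    Close 0, Open 5, Open 6, Edge 3 6, Edge 5 6, Close 6, Open 7, Edge 3 7, Close 3, Edge 4 7,
    Edge 7 10, Close 7, Edge 1 5, Edge 5 10, Close 5, Open 8, Edge 1 8, Close 1, Edge 4 8, Close 4,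
    Open 9, Edge 8 9, Edge 9 10, Close 9, Close 8]"

text \<open>Up to four vertices stay open after a closing here.\<close>

definition cube_witnesses :: "witness list list" where
  "cube_witnesses = [
    [
      Cover 0 0 [D1, D0], Keep, Keep, Cover 0 0 [D1, D1]],
    [
      Keep, Keep, Cover 1 1 [D0, D0, D3], Cover 0 1 [D0, D0, D3], Keep, Keep,
      Cover 2 0 [D0, D0, D2], Cover 3 0 [D0, D0, D2]],
    [
      Cover 0 0 [D1, D0, D0, D0], Keep, Keep, Cover 0 0 [D1, D0, D1, D0],
      Cover 2 0 [D1, D0, D0, D0], Keep, Keep, Cover 2 0 [D1, D0, D1, D0],
      Cover 4 0 [D1, D0, D0, D0], Keep, Keep, Cover 4 0 [D1, D0, D1, D0],
      Cover 6 0 [D1, D0, D0, D0], Keep, Keep, Cover 6 0 [D1, D0, D1, D0]],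
    [
      Keep, Keep, Keep, Keep, Keep, Keep, Cover 4 0 [D0, D2, D0, D0], Cover 5 0 [D0, D2, D0, D0],
      Keep, Keep, Keep, Keep, Keep, Keep, Cover 10 0 [D0, D2, D0, D0], Cover 11 0 [D0, D2, D0, D0],
      Keep, Keep, Cover 13 1 [D0, D3, D0, D0], Cover 12 1 [D0, D3, D0, D0], Keep, Keep,
      Cover 14 0 [D0, D2, D0, D0], Cover 15 0 [D0, D2, D0, D0], Keep, Keep,
      Cover 17 1 [D0, D3, D0, D2], Cover 16 1 [D0, D3, D0, D2], Keep, Keep,
      Cover 18 0 [D0, D2, D0, D0], Cover 19 0 [D0, D2, D0, D0]],
    [
      Keep, Keep, Keep, Cover 0 1 [D3, D3, D3], Cover 1 1 [D3, D0, D3], Cover 0 1 [D3, D0, D3],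
      Cover 0 0 [D0, D1, D0], Cover 2 1 [D3, D0, D3], Cover 0 0 [D0, D2, D0],
      Cover 1 0 [D0, D2, D0], Cover 0 0 [D0, D0, D0], Cover 0 1 [D3, D1, D3], Keep,
      Cover 0 1 [D3, D2, D3], Cover 0 0 [D0, D3, D0], Cover 3 1 [D3, D1, D3], Keep, Keep,
      Cover 6 1 [D2, D0, D3], Keep, Cover 6 1 [D2, D1, D3], Cover 4 0 [D2, D0, D0],
      Cover 4 0 [D2, D3, D0], Cover 4 1 [D2, D1, D3], Cover 0 1 [D3, D1, D3],
      Cover 0 0 [D0, D2, D0], Cover 2 1 [D3, D1, D3], Cover 1 1 [D3, D1, D3],
      Cover 2 1 [D3, D2, D3], Cover 1 1 [D3, D2, D3], Cover 0 1 [D3, D2, D3],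
      Cover 0 0 [D0, D3, D0], Cover 0 0 [D0, D1, D0], Cover 0 0 [D0, D0, D0],
      Cover 0 0 [D0, D3, D0], Cover 0 0 [D0, D2, D0], Cover 1 0 [D0, D1, D0],
      Cover 0 0 [D0, D3, D0], Cover 0 1 [D3, D0, D3], Cover 0 0 [D0, D1, D0],
      Cover 6 0 [D2, D0, D0], Cover 4 0 [D2, D0, D0], Cover 4 1 [D2, D2, D3],
      Cover 4 0 [D0, D0, D0], Cover 4 1 [D0, D1, D3], Cover 4 0 [D0, D1, D0],
      Cover 6 0 [D2, D1, D0], Cover 4 0 [D2, D1, D0], Keep, Keep, Keep, Cover 8 0 [D0, D0, D2],
      Cover 7 0 [D0, D1, D2], Cover 8 0 [D0, D1, D2], Cover 7 0 [D0, D1, D0],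
      Cover 7 0 [D0, D0, D0], Keep, Cover 12 0 [D2, D0, D2], Cover 10 0 [D2, D2, D2],
      Cover 12 0 [D2, D0, D0], Keep, Cover 12 0 [D2, D1, D0], Cover 11 0 [D0, D0, D2],
      Cover 12 0 [D2, D1, D2], Cover 8 0 [D0, D2, D2], Cover 7 1 [D3, D3, D2],
      Cover 7 0 [D0, D1, D0], Cover 7 0 [D0, D2, D2], Cover 8 0 [D0, D3, D0],
      Cover 7 0 [D0, D3, D2], Cover 7 0 [D0, D0, D0], Cover 7 0 [D0, D3, D0], Keep, Keep,
      Cover 10 0 [D0, D1, D0], Cover 13 1 [D0, D0, D2], Cover 10 0 [D2, D0, D0],
      Cover 10 0 [D0, D1, D0], Cover 10 0 [D0, D0, D0], Cover 10 0 [D2, D1, D0]],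
    [
      Keep, Keep, Keep, Cover 6 0 [D1, D0], Cover 1 0 [D3, D1], Cover 0 0 [D0, D0],
      Cover 0 0 [D0, D3], Cover 0 0 [D1, D3], Cover 0 0 [D0, D0], Cover 0 0 [D1, D0],
      Cover 0 0 [D1, D0], Cover 0 0 [D3, D0], Cover 0 0 [D2, D1], Cover 0 0 [D0, D0],
      Cover 0 0 [D0, D0], Cover 0 0 [D1, D3], Cover 0 0 [D0, D0], Keep, Keep, Cover 0 0 [D0, D0],
      Cover 0 1 [D2, D3], Cover 0 0 [D0, D0], Keep, Cover 6 0 [D1, D0], Cover 2 0 [D0, D1],
      Cover 0 0 [D0, D0], Cover 2 0 [D2, D1], Cover 0 0 [D0, D0], Keep, Cover 2 1 [D1, D0],
      Cover 0 0 [D0, D2], Keep, Cover 3 0 [D3, D3], Cover 0 0 [D0, D0], Cover 0 0 [D0, D0],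
      Cover 3 0 [D0, D1], Cover 6 0 [D0, D2], Cover 0 0 [D3, D0], Cover 0 0 [D0, D0],
      Cover 5 1 [D1, D1], Cover 5 0 [D3, D0], Cover 5 0 [D1, D1], Cover 5 0 [D1, D0],
      Cover 5 1 [D3, D3], Cover 5 0 [D2, D0], Cover 5 0 [D0, D1], Cover 5 0 [D0, D0],
      Cover 6 0 [D0, D0], Keep, Cover 3 0 [D2, D3], Cover 8 0 [D2, D0], Cover 3 0 [D0, D3],
      Cover 5 0 [D1, D0], Cover 5 1 [D3, D3], Cover 5 0 [D3, D0], Cover 5 1 [D1, D3]],
    [
      Keep, Cover 1 1 [D0, D0], Cover 0 1 [D0, D1], Keep, Keep, Cover 0 0 [D0, D1],
      Cover 0 1 [D0, D1], Keep, Cover 0 0 [D0, D0], Cover 0 1 [D0, D1], Keep, Keep,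
      Cover 0 0 [D0, D0], Keep, Cover 0 0 [D0, D0], Cover 6 1 [D0, D2], Keep, Cover 1 1 [D0, D2],
      Cover 9 0 [D0, D1], Cover 1 0 [D0, D2], Cover 1 1 [D0, D0], Cover 9 0 [D0, D0],
      Cover 0 1 [D0, D2], Keep, Keep, Cover 1 0 [D0, D0], Keep, Cover 1 0 [D0, D3], Keep,
      Cover 1 1 [D0, D1], Cover 9 0 [D0, D1], Cover 0 1 [D0, D1], Cover 1 1 [D0, D2],
      Cover 8 0 [D0, D0], Cover 1 0 [D0, D2], Keep],
    [
      Keep, Cover 0 0 [D0], Cover 0 0 [D0], Cover 0 0 [D0], Cover 0 0 [D0], Cover 0 0 [D0],
      Cover 0 0 [D0], Cover 0 0 [D2], Cover 0 0 [D0], Cover 0 0 [D0], Cover 0 0 [D0],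
      Cover 0 0 [D0], Cover 0 0 [D0], Cover 0 0 [D0], Cover 0 0 [D0], Cover 0 0 [D0],
      Cover 0 0 [D2], Cover 0 0 [D0], Cover 0 0 [D0], Cover 0 0 [D0], Cover 0 0 [D0],
      Cover 0 0 [D0], Cover 0 0 [D0], Cover 0 0 [D0], Cover 0 0 [D3], Cover 0 0 [D0],
      Cover 0 0 [D0], Cover 0 0 [D0], Cover 0 0 [D0], Cover 0 0 [D0], Cover 0 0 [D0],
      Cover 0 0 [D0], Cover 0 0 [D2], Cover 0 0 [D0], Cover 0 0 [D3], Cover 0 0 [D0],
      Cover 0 0 [D3], Cover 0 0 [D0], Cover 0 0 [D0], Cover 0 0 [D0], Cover 0 0 [D0],
      Cover 0 0 [D0], Cover 0 0 [D3], Cover 0 0 [D0], Cover 0 0 [D0], Cover 0 0 [D0],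
      Cover 0 0 [D0], Cover 0 0 [D3], Cover 0 0 [D3], Cover 0 0 [D0], Cover 0 0 [D0], Cover 0 0 [D0]],
    [
      Keep, Cover 0 0 [D0], Cover 0 0 [D0], Cover 0 0 [D0]],
    [
      Keep, Cover 0 0 [], Cover 0 0 [], Cover 0 0 []]]"

text \<open>The pairs barred on the three subdivided edges, {\<open>D1\<close>,\<open>D2\<close>},
  {\<open>D0\<close>,\<open>D1\<close>} and {\<open>D0\<close>,\<open>D2\<close>}, are cosets of the
  three different subgroups of order two.\<close>

definition cube_forbidden :: "digit list" where
  "cube_forbidden = [
    D1, D2, D0, D1, D1, D0, D1, D0, D2, D1, D0, D0, D0, D2, D0]"

lemma cube_program: "upward_edges 10 (edges cube_program)" "valid cube_program []"
  "opens cube_program = [0..<10]"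
  by code_simp+

lemma cube_connected: "graph_group_connected TYPE(4) {..10} (edge_sets (edges cube_program))"
proof (rule z4.connectedI[OF cube_program auts4])
  show "check sub4 auts4 cube_program cube_witnesses [] [Full]"
    by code_simp
qed

lemma cube_not_connected:
  "\<not> graph_group_connected TYPE(2 \<times> 2) {..10} (edge_sets (edges cube_program))"
proof (rule z22.not_connectedI[OF cube_program])
  show "length cube_forbidden = length (edges cube_program)"
    by code_simp
  show "\<not> run sub22 (demand sub22 (edges cube_program) cube_forbidden) cube_program [] Full"
    by code_simp
qed

theorem theorem3:
  shows "(\<exists>(V :: nat set) E. finite_simple_graph V E \<and>
            graph_group_connected TYPE(2 \<times> 2) V E \<and> \<not> graph_group_connected TYPE(4) V E) \<and>
         (\<exists>(V :: nat set) E. finite_simple_graph V E \<and>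
            graph_group_connected TYPE(4) V E \<and> \<not> graph_group_connected TYPE(2 \<times> 2) V E)"
  using upward_edges_simple(1)[OF cubic12_program(1)] cubic12_connected cubic12_not_connected
    upward_edges_simple(1)[OF cube_program(1)] cube_connected cube_not_connected
  by blast

end
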